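(* Let $m\ge4$, let $k$ be a positive integer with $k\mid m$ and $k\notin\{m,\frac m2\}$, and let $f(x)=\mathrm{Tr}_k^m(x^{2^k+1})$ on $\mathbb{F}_{2^m}$. Let $D=\{x\in\mathbb{F}_{2^m}^*:\mathrm{Tr}(x)=1\}$ and $\mathcal{C}(f)^{\bar D}=\{(\mathrm{Tr}(af(x)+bx))_{x\in D}:a,b\in\mathbb{F}_{2^m}\}$. Let $t=2^{\frac{m+2k-2}{2}}$ if $v_2(m)>v_2(k)+1$, $t=2^{\frac{m+2k-4}{2}}$ if $v_2(m)=v_2(k)+1$, and $t=2^{\frac{m+k-4}{2}}$ if $v_2(m)=v_2(k)$. Then $\mathcal{C}(f)^{\bar D}$ is a $[2^{m-1},m+k,2^{m-2}-t]$ binary code with weight distribution: weight $0$ once; weight $2^{m-2}$ with multiplicity $2^{m+k}-2+2^{2m-3}(1-2^k)/t^2$; each of the weights $2^{m-2}\pm t$ with multiplicity $2^{2m-4}(2^k-1)/t^2$; weight $2^{m-1}$ once. Its dual has parameters $[2^{m-1},2^{m-1}-m-k,4]$ and is distance-optimal with respect to the sphere packing bound.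
   Context: $\mathrm{Tr}$ is the absolute trace from $\mathbb{F}_{2^m}$ to $\mathbb{F}_2$, $\mathrm{Tr}_k^m$ is the trace from $\mathbb{F}_{2^m}$ to $\mathbb{F}_{2^k}$, and $v_2$ is the 2-adic order function. An $[n,k,d]$ binary code is a $k$-dimensional linear subspace of $\mathbb{F}_2^n$ with minimum Hamming distance $d$; the dual is taken with respect to the standard inner product. The multiplicity of a weight is the number of codewords of that weight. An $[n,k,d]$ binary code is distance-optimal if there is no $[n,k,d']$ binary linear code with $d'\ge d+1$; the phrase "with respect to the sphere packing bound" asserts distance-optimality in this sense, and names the bound $2^n\ge 2^k\sum_{i=0}^{\lfloor (d-1)/2\rfloor}\binom ni$ (valid for every $[n,k,d]$ binary code) as the bound used to establish it. The notation $\mathcal{C}(f)^{\bar D}$ indicates puncturing on $\bar D=\mathbb{F}_{2^m}^*\setminus D$.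
   Formalization: The pair m = 4, k = 1 is excluded: there t = 4 = 2^{m-2}, so the claimed minimum distance is 0, and since f(x) = 1 for all x in D the code has dimension 4 instead of m + k = 5, so the claim is false. *)

theory Defs
  imports Complex_Main "HOL-Library.Z2" "HOL-Library.Function_Algebras"
    "HOL-Computational_Algebra.Primes"
begin

(* The trace from GF(2^m) to GF(2^k), for k dividing m, as a map of GF(2^m) into itself. *)
definition rel_trace :: "nat \<Rightarrow> nat \<Rightarrow> 'a::field \<Rightarrow> 'a" where
  "rel_trace m k x = (\<Sum>i<m div k. x ^ (2 ^ (k * i)))"

(* On GF(2^m) the sum rel_trace m 1 x lies in the prime field {0, 1}, which is identified
   with the two-element field bit. *)
definition abs_trace :: "nat \<Rightarrow> 'a::field \<Rightarrow> bit" where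
  "abs_trace m x = (if rel_trace m 1 x = 0 then 0 else 1)"

(* F_2^n with coordinates indexed by a set I of size n; a vector is a function on the whole
   index type that is 0 outside I. *)
definition F2_space :: "'i set \<Rightarrow> ('i \<Rightarrow> bit) set" where
  "F2_space I = {v. \<forall>i. i \<notin> I \<longrightarrow> v i = 0}"

global_interpretation F2: vector_space "\<lambda>(c::bit) (v::'i \<Rightarrow> bit). (\<lambda>i. c * v i)"
  defines F2_subspace = F2.subspace
    and F2_dim = F2.dim
  by unfold_locales (auto simp: fun_eq_iff algebra_simps)

definition hamming_dist :: "('i \<Rightarrow> bit) \<Rightarrow> ('i \<Rightarrow> bit) \<Rightarrow> nat" where
  "hamming_dist u v = card {i. u i \<noteq> v i}"

definition weight :: "('i \<Rightarrow> bit) \<Rightarrow> nat" where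
  "weight v = card {i. v i \<noteq> 0}"

(* A relation rather than a function: a code with at most one codeword has no minimum
   distance. *)
definition has_min_dist :: "('i \<Rightarrow> bit) set \<Rightarrow> nat \<Rightarrow> bool" where
  "has_min_dist C d \<longleftrightarrow>
     (\<exists>u\<in>C. \<exists>v\<in>C. u \<noteq> v \<and> hamming_dist u v = d) \<and>
     (\<forall>u\<in>C. \<forall>v\<in>C. u \<noteq> v \<longrightarrow> d \<le> hamming_dist u v)"

definition binary_code :: "'i set \<Rightarrow> ('i \<Rightarrow> bit) set \<Rightarrow> nat \<Rightarrow> nat \<Rightarrow> nat \<Rightarrow> bool" where
  "binary_code I C n k d \<longleftrightarrow>
     finite I \<and> card I = n \<and> C \<subseteq> F2_space I \<and> F2_subspace C \<and> F2_dim C = k \<and>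
     has_min_dist C d"

definition dual_code :: "'i set \<Rightarrow> ('i \<Rightarrow> bit) set \<Rightarrow> ('i \<Rightarrow> bit) set" where
  "dual_code I C = {v \<in> F2_space I. \<forall>c\<in>C. (\<Sum>i\<in>I. v i * c i) = 0}"

(* Competing codes may be taken with coordinate set {..<n}, as relabelling coordinates
   does not change the parameters. *)
definition distance_optimal ::
    "'i set \<Rightarrow> ('i \<Rightarrow> bit) set \<Rightarrow> nat \<Rightarrow> nat \<Rightarrow> nat \<Rightarrow> bool" where
  "distance_optimal I C n k d \<longleftrightarrow>
     binary_code I C n k d \<and>
     (\<nexists>C' d'. d' \<ge> d + 1 \<and> binary_code ({..<n} :: nat set) C' n k d')"

definition weight_mult :: "('i \<Rightarrow> bit) set \<Rightarrow> nat \<Rightarrow> nat" where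
  "weight_mult C w = card {c \<in> C. weight c = w}"

definition trace_one_set :: "nat \<Rightarrow> 'a::field set" where
  "trace_one_set m = {x. x \<noteq> 0 \<and> abs_trace m x = 1}"

(* The code C(f) punctured to the coordinates in D. *)
definition trace_code :: "nat \<Rightarrow> ('a::field \<Rightarrow> 'a) \<Rightarrow> 'a set \<Rightarrow> ('a \<Rightarrow> bit) set" where
  "trace_code m f D =
     {(\<lambda>x. if x \<in> D then abs_trace m (a * f x + b * x) else 0) | a b. True}"

end

theory Submission
  imports Defs "HOL-Computational_Algebra.Polynomial"
begin

text \<open>With \<open>\<beta> = Tr\<^sub>k(a)\<close> the codewords are \<open>x \<mapsto> Tr(\<beta> x\<^bsup>2^k+1\<^esup> + b x)\<close> on the affine hyperplane
  \<open>Tr x = 1\<close>, with \<open>\<beta>\<close> ranging over the subfield \<open>GF(2\<^sup>k)\<close>. Squaring the character sum of a word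
  over this hyperplane leaves a sum of an additive character over the group \<open>U\<close> of all \<open>u\<close> with
  \<open>Tr u = 0\<close> and \<open>\<beta> (u\<^bsup>2^k\<^esup> + u\<^bsup>2^(m-k)\<^esup>) \<in> {0, 1}\<close>, so the square is \<open>0\<close> or \<open>2\<^bsup>m-1\<^esup> |U| = 4 t\<^sup>2\<close>. The
  code contains the all-one word, which pairs the weights \<open>2\<^bsup>m-2\<^esup> \<plusminus> t\<close>, and the second power moment
  then gives their common multiplicity. The dual has even weights and no word of weight 2, and the
  sphere packing bound excludes minimum distance at least 5.\<close>

section \<open>Binary linear codes\<close>

text \<open>As simplification rules these two equations replace the field operations on \<open>bit\<close> by bit
  operations, for which no sum lemmas exist.\<close>

declare add_bit_eq_xor [simp del] mult_bit_eq_and [simp del]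

lemma bit_add_self [simp]: "b + b = (0 :: bit)"
  by (cases b) simp_all

section \<open>Sums of sign characters over finite additive groups\<close>

definition bit_sign :: "bit \<Rightarrow> int" where
  "bit_sign b = (if b = 0 then 1 else - 1)"

lemma bit_sign_simps [simp]: "bit_sign 0 = 1" "bit_sign 1 = - 1"
  by (simp_all add: bit_sign_def)

lemma bit_sign_add: "bit_sign (a + b) = bit_sign a * bit_sign b"
  by (cases a; cases b) simp_all

text \<open>Translation by \<open>u\<close> is injective on the finite set \<open>G\<close>, hence
  permutes it, and it flips the sign of every term; so the sum equals its own negative.\<close>

lemma sum_bit_sign_eq_0:
  fixes g :: "'b::ab_group_add \<Rightarrow> bit"
  assumes fin: "finite G" and closed: "\<And>x y. x \<in> G \<Longrightarrow> y \<in> G \<Longrightarrow> x + y \<in> G"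
    and additive: "\<And>x y. x \<in> G \<Longrightarrow> y \<in> G \<Longrightarrow> g (x + y) = g x + g y"
    and u: "u \<in> G" "g u \<noteq> 0"
  shows "(\<Sum>x\<in>G. bit_sign (g x)) = 0"
proof -
  have "(+) u ` G = G"
    using closed u(1) by (intro endo_inj_surj fin) auto
  then have "(\<Sum>x\<in>G. bit_sign (g x)) = (\<Sum>x\<in>(+) u ` G. bit_sign (g x))"
    by simp
  also have "\<dots> = (\<Sum>x\<in>G. bit_sign (g (u + x)))"
    by (subst sum.reindex) auto
  also have "\<dots> = (\<Sum>x\<in>G. bit_sign (g u) * bit_sign (g x))"
    using u by (intro sum.cong) (auto simp: additive bit_sign_add simp del: bit_not_zero_iff)
  also have "\<dots> = - (\<Sum>x\<in>G. bit_sign (g x))"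
    using u(2) by (simp add: sum_negf)
  finally show ?thesis
    by simp
qed

lemma sum_bit_sign_cases:
  fixes g :: "'b::ab_group_add \<Rightarrow> bit"
  assumes "finite G" "\<And>x y. x \<in> G \<Longrightarrow> y \<in> G \<Longrightarrow> x + y \<in> G"
    and "\<And>x y. x \<in> G \<Longrightarrow> y \<in> G \<Longrightarrow> g (x + y) = g x + g y"
  shows "(\<Sum>x\<in>G. bit_sign (g x)) \<in> {0, int (card G)}"
proof (cases "\<exists>u\<in>G. g u \<noteq> 0")
  case True
  then show ?thesis
    using sum_bit_sign_eq_0[of G g] assms by blast
next
  case False
  then have "(\<Sum>x\<in>G. bit_sign (g x)) = (\<Sum>x\<in>G. 1)"
    by (intro sum.cong) auto
  then show ?thesis
    by simp
qed

lemma sum_bit_sign_eq_card: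
  assumes "finite G"
  shows "(\<Sum>x\<in>G. bit_sign (g x)) = int (card G) - 2 * int (card {x \<in> G. g x \<noteq> 0})"
proof -
  have "(\<Sum>x\<in>G. bit_sign (g x)) = (\<Sum>x\<in>G. 1 - 2 * (if g x \<noteq> 0 then 1 else 0))"
    by (intro sum.cong) (auto simp: bit_sign_def)
  then show ?thesis
    using assms by (simp add: sum_subtractf sum.If_cases sum_distrib_left[symmetric] Int_def del: bit_not_zero_iff)
qed

lemma card_additive_kernel:
  fixes g :: "'b::ab_group_add \<Rightarrow> bit"
  assumes fin: "finite G" and closed: "\<And>x y. x \<in> G \<Longrightarrow> y \<in> G \<Longrightarrow> x + y \<in> G"
    and additive: "\<And>x y. x \<in> G \<Longrightarrow> y \<in> G \<Longrightarrow> g (x + y) = g x + g y"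
    and u: "u \<in> G" "g u \<noteq> 0"
  shows "2 * card {x \<in> G. g x = 0} = card G" "2 * card {x \<in> G. g x = 1} = card G"
proof -
  show *: "2 * card {x \<in> G. g x = 1} = card G"
    using sum_bit_sign_eq_0[of G g, OF assms] sum_bit_sign_eq_card[OF fin, of g] by simp
  have "G = {x \<in> G. g x = 0} \<union> {x \<in> G. g x = 1}"
    by auto
  then have "card G = card {x \<in> G. g x = 0} + card {x \<in> G. g x = 1}"
    using fin by (subst card_Un_disjoint[symmetric]) auto
  then show "2 * card {x \<in> G. g x = 0} = card G"
    using * by simp
qed

section \<open>Subspaces of binary space and their duals, by counting\<close>

lemma bit_fun_add_self [simp]: "v + v = (0 :: 'i \<Rightarrow> bit)"
  by (auto simp: fun_eq_iff)

lemma bit_fun_minus: "u - v = u + (v :: 'i \<Rightarrow> bit)"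
  by (auto simp: fun_eq_iff)

lemma F2_subspace_iff: "F2_subspace C \<longleftrightarrow> 0 \<in> C \<and> (\<forall>u\<in>C. \<forall>v\<in>C. u + v \<in> C)"
proof -
  have "(\<lambda>i. c * v i) \<in> C" if "0 \<in> C" "v \<in> C" for c and v :: "'a \<Rightarrow> bit"
    using that by (cases c) (auto simp: zero_fun_def)
  then show ?thesis
    by (auto simp: F2.subspace_def)
qed

text \<open>A vector \<open>b\<close> outside the span of \<open>B\<close> doubles it: as the only
  scalars are 0 and 1, the new span is the disjoint union of the old one and its translate by
  \<open>b\<close>.\<close>

lemma card_F2_span:
  assumes "finite B" "\<not> F2.dependent B"
  shows "finite (F2.span B) \<and> card (F2.span B) = 2 ^ card B"
  using assms
proof (induction B rule: finite_induct)
  case empty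
  then show ?case
    by (simp only: F2.span_empty) simp
next
  case (insert b B)
  have ind: "\<not> F2.dependent B"
    using insert.prems F2.dependent_mono by blast
  have b: "b \<notin> F2.span B"
    using insert.prems insert.hyps F2.independent_insert by metis
  have span: "F2.span (insert b B) = F2.span B \<union> (+) b ` F2.span B"
  proof (intro equalityI subsetI)
    fix x assume "x \<in> F2.span (insert b B)"
    then obtain c where c: "x - (\<lambda>i. c * b i) \<in> F2.span B"
      using F2.span_breakdown_eq by blast
    have "x \<in> F2.span B \<or> x + b \<in> F2.span B"
      using c by (cases c) (simp_all add: bit_fun_minus flip: zero_fun_def)
    moreover have "x = b + (x + b)"
      by (simp only: add.left_commute[of b] bit_fun_add_self add_0_right)
    ultimately show "x \<in> F2.span B \<union> (+) b ` F2.span B"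
      by blast
  next
    fix x assume x: "x \<in> F2.span B \<union> (+) b ` F2.span B"
    have "b \<in> F2.span (insert b B)"
      by (simp add: F2.span_base)
    moreover have "F2.span B \<subseteq> F2.span (insert b B)"
      by (intro F2.span_mono) auto
    ultimately show "x \<in> F2.span (insert b B)"
      using x by (auto intro: F2.span_add)
  qed
  have disj: "F2.span B \<inter> (+) b ` F2.span B = {}"
  proof (rule equals0I)
    fix x assume "x \<in> F2.span B \<inter> (+) b ` F2.span B"
    then obtain y where "x \<in> F2.span B" "y \<in> F2.span B" "x = b + y"
      by auto
    then have "b = x - y"
      by simp
    then show False
      using b F2.span_diff[OF \<open>x \<in> F2.span B\<close> \<open>y \<in> F2.span B\<close>] by simp
  qed
  have "card ((+) b ` F2.span B) = card (F2.span B)"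
    by (intro card_image) auto
  then show ?case
    using insert ind disj by (simp add: span card_Un_disjoint)
qed

lemma card_F2_subspace:
  assumes C: "F2_subspace C" and fin: "finite C"
  shows "card C = 2 ^ F2_dim C"
proof -
  obtain B where B: "B \<subseteq> C" "\<not> F2.dependent B" "C \<subseteq> F2.span B" "card B = F2_dim C"
    using F2.basis_exists[of C] by blast
  have "F2.span B = C"
    using B C by (intro F2.span_subspace) auto
  then show ?thesis
    using card_F2_span[of B] B fin finite_subset by metis
qed

text \<open>The dimensions of the code and of its dual are both obtained this way, from a count of
  codewords.\<close>

lemma F2_dim_eqI:
  assumes "F2_subspace C" "finite C" "card C = 2 ^ k"
  shows "F2_dim C = k"
  using card_F2_subspace[OF assms(1,2)] assms(3) by simp

lemma F2_subspace_F2_space: "F2_subspace (F2_space I)"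
  by (auto simp: F2_subspace_iff F2_space_def)

text \<open>Serves as the all-one word on a coordinate set, as a unit vector, and as an error
  pattern in the sphere packing argument.\<close>

definition F2_indicator :: "'i set \<Rightarrow> 'i \<Rightarrow> bit" where
  "F2_indicator E = (\<lambda>i. if i \<in> E then 1 else 0)"

lemma F2_indicator_inject: "F2_indicator E = F2_indicator E' \<longleftrightarrow> E = E'"
  by (force simp: F2_indicator_def fun_eq_iff split: if_splits)

lemma bij_betw_F2_indicator: "bij_betw F2_indicator (Pow I) (F2_space I)"
proof (rule bij_betw_byWitness[where f' = "\<lambda>v. {i. v i \<noteq> 0}"])
  show "\<forall>v\<in>F2_space I. F2_indicator {i. v i \<noteq> 0} = v"
    by (auto simp: F2_indicator_def F2_space_def fun_eq_iff)
qed (auto simp: F2_indicator_def F2_space_def)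

lemma finite_F2_space: "finite I \<Longrightarrow> finite (F2_space I)"
  using bij_betw_finite[OF bij_betw_F2_indicator, of I] by simp

lemma card_F2_space: "finite I \<Longrightarrow> card (F2_space I) = 2 ^ card I"
  using bij_betw_same_card[OF bij_betw_F2_indicator, of I] by (simp add: card_Pow)

lemma F2_subspace_dual_code: "F2_subspace (dual_code I C)"
  by (auto simp: F2_subspace_iff dual_code_def F2_space_def distrib_right sum.distrib)

text \<open>Double counting of the sign of the inner product over all pairs of a vector and a
  codeword. Summing over \<open>C\<close> first leaves only the vectors of the dual; summing over
  the vectors first leaves only the zero codeword.\<close>

lemma card_dual_code:
  assumes fin: "finite I" and C: "C \<subseteq> F2_space I" "F2_subspace C"
  shows "card C * card (dual_code I C) = 2 ^ card I"
proof -
  let ?V = "F2_space I"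
  define ip where "ip = (\<lambda>v c :: 'a \<Rightarrow> bit. \<Sum>i\<in>I. v i * c i)"
  have finV: "finite ?V" and finC: "finite C"
    using finite_F2_space[OF fin] C finite_subset by auto
  have add: "ip (u + v) c = ip u c + ip v c" "ip c (u + v) = ip c u + ip c v" for u v c
    by (simp_all add: ip_def distrib_left distrib_right sum.distrib)
  have V: "u + v \<in> ?V" if "u \<in> ?V" "v \<in> ?V" for u v
    using that F2_subspace_F2_space F2_subspace_iff by blast
  have C': "u + v \<in> C" if "u \<in> C" "v \<in> C" for u v
    using that C F2_subspace_iff by blast
  have 1: "(\<Sum>c\<in>C. bit_sign (ip v c)) = (if v \<in> dual_code I C then int (card C) else 0)"
    if v: "v \<in> ?V" for v
  proof (cases "v \<in> dual_code I C")
    case True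
    then have "(\<Sum>c\<in>C. bit_sign (ip v c)) = (\<Sum>c\<in>C. 1)"
      by (intro sum.cong) (auto simp: dual_code_def ip_def)
    then show ?thesis
      using True by simp
  next
    case False
    then obtain c where "c \<in> C" "ip v c \<noteq> 0"
      using v by (auto simp: dual_code_def ip_def)
    then show ?thesis
      using False by (simp add: sum_bit_sign_eq_0[of C "ip v", OF finC C' add(2)] del: bit_not_zero_iff)
  qed
  have 2: "(\<Sum>v\<in>?V. bit_sign (ip v c)) = (if c = 0 then 2 ^ card I else 0)" if "c \<in> C" for c
  proof (cases "c = 0")
    case True
    then show ?thesis
      by (simp add: ip_def card_F2_space fin)
  next
    case False
    \<comment> \<open>The unit vector at such a coordinate pairs nontrivially with
      \<open>c\<close>.\<close>
    then obtain i where i: "c i = 1"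
      by (auto simp: fun_eq_iff)
    have "i \<in> I"
      using i subsetD[OF C(1) that] by (auto simp: F2_space_def)
    moreover have "ip (F2_indicator {i}) c = (\<Sum>j\<in>I. if j = i then c j else 0)"
      unfolding ip_def by (intro sum.cong) (auto simp: F2_indicator_def)
    ultimately have "ip (F2_indicator {i}) c \<noteq> 0" "F2_indicator {i} \<in> ?V"
      using i fin by (auto simp: F2_indicator_def F2_space_def)
    then show ?thesis
      using False by (simp add: sum_bit_sign_eq_0[of ?V "\<lambda>v. ip v c", OF finV V add(1)] del: bit_not_zero_iff)
  qed
  have "int (card C * card (dual_code I C)) = (\<Sum>v\<in>?V. \<Sum>c\<in>C. bit_sign (ip v c))"
  proof -
    have "dual_code I C \<subseteq> ?V"
      by (auto simp: dual_code_def)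
    then have "?V \<inter> dual_code I C = dual_code I C"
      by auto
    then show ?thesis
      using finV by (simp add: 1 sum.If_cases)
  qed
  also have "\<dots> = (\<Sum>c\<in>C. \<Sum>v\<in>?V. bit_sign (ip v c))"
    by (rule sum.swap)
  also have "\<dots> = 2 ^ card I"
    using C finC by (simp add: 2 F2_subspace_iff)
  finally have "int (card C * card (dual_code I C)) = int (2 ^ card I)"
    by simp
  then show ?thesis
    by (simp only: of_nat_eq_iff)
qed

lemma hamming_dist_eq_weight: "hamming_dist u v = weight (u + v)"
proof -
  have "u i \<noteq> v i \<longleftrightarrow> (u + v) i \<noteq> 0" for i
    by (cases "u i"; cases "v i") auto
  then show ?thesis
    by (simp add: hamming_dist_def weight_def)
qed

lemma has_min_dist_F2_subspace:
  assumes "F2_subspace C"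
  shows "has_min_dist C d \<longleftrightarrow>
    (\<exists>c\<in>C. c \<noteq> 0 \<and> weight c = d) \<and> (\<forall>c\<in>C. c \<noteq> 0 \<longrightarrow> d \<le> weight c)"
proof -
  have C: "0 \<in> C" "\<And>u v. u \<in> C \<Longrightarrow> v \<in> C \<Longrightarrow> u + v \<in> C"
    using assms by (auto simp: F2_subspace_iff)
  have eq: "u + v = 0 \<longleftrightarrow> u = v" for u v :: "'a \<Rightarrow> bit"
    by (metis bit_fun_minus right_minus_eq)
  have ex: "(\<exists>u\<in>C. \<exists>v\<in>C. R (u + v)) \<longleftrightarrow> (\<exists>c\<in>C. R c)" for R
  proof
    assume "\<exists>c\<in>C. R c"
    then obtain c where "c \<in> C" "R c"
      by blast
    then show "\<exists>u\<in>C. \<exists>v\<in>C. R (u + v)"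
      using C(1) by (intro bexI[of _ c] bexI[of _ 0]) auto
  qed (use C(2) in blast)
  have "(\<exists>u\<in>C. \<exists>v\<in>C. u \<noteq> v \<and> hamming_dist u v = d) \<longleftrightarrow> (\<exists>c\<in>C. c \<noteq> 0 \<and> weight c = d)"
    unfolding hamming_dist_eq_weight using ex[of "\<lambda>c. c \<noteq> 0 \<and> weight c = d"] by (simp add: eq)
  moreover have "(\<forall>u\<in>C. \<forall>v\<in>C. u \<noteq> v \<longrightarrow> d \<le> hamming_dist u v) \<longleftrightarrow>
      (\<forall>c\<in>C. c \<noteq> 0 \<longrightarrow> d \<le> weight c)"
    unfolding hamming_dist_eq_weight using ex[of "\<lambda>c. \<not> (c \<noteq> 0 \<longrightarrow> d \<le> weight c)"]
    by (simp add: eq) blast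
  ultimately show ?thesis
    unfolding has_min_dist_def by simp
qed

text \<open>A point of the ball of radius 2 around \<open>c\<close> is \<open>c\<close> plus the
  indicator of an error set \<open>E\<close> of size at most 2. Two such representations with
  different centres would put codewords at distance at most 4, so the pairs \<open>(c, E)\<close>
  embed into the whole space.\<close>

lemma sphere_packing_radius_2:
  assumes "binary_code I C n k d" "d \<ge> 5"
  shows "2 ^ k * (1 + n + (n choose 2)) \<le> (2 :: nat) ^ n"
proof -
  have I: "finite I" "card I = n" and C: "C \<subseteq> F2_space I" "F2_subspace C" "F2_dim C = k"
    and dist: "\<And>u v. u \<in> C \<Longrightarrow> v \<in> C \<Longrightarrow> u \<noteq> v \<Longrightarrow> 5 \<le> hamming_dist u v"
    using assms unfolding binary_code_def has_min_dist_def by (auto intro: order_trans)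
  let ?S = "\<lambda>j. {E. E \<subseteq> I \<and> card E = j}"
  define S where "S = ?S 0 \<union> ?S 1 \<union> ?S 2"
  have finS: "finite (?S j)" for j
    using I by simp
  have "card S = card (?S 0) + card (?S 1) + card (?S 2)"
    unfolding S_def using finS by (subst card_Un_disjoint; (subst card_Un_disjoint)?) auto
  then have cardS: "card S = 1 + n + (n choose 2)"
    using I by (simp add: n_subsets)
  have S: "finite E" "E \<subseteq> I" "card E \<le> 2" if "E \<in> S" for E
    using that I finite_subset by (auto simp: S_def)
  have finC: "finite C"
    using C(1) I finite_F2_space finite_subset by blast
  have "inj_on (\<lambda>(c, E). c + F2_indicator E) (C \<times> S)"
  proof (rule inj_onI, clarify)
    fix c E c' E' assume *: "c \<in> C" "E \<in> S" "c' \<in> C" "E' \<in> S"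
      and eq: "c + F2_indicator E = c' + F2_indicator E'"
    have "c = c'"
    proof (rule ccontr)
      assume "c \<noteq> c'"
      have eq': "c i + F2_indicator E i = c' i + F2_indicator E' i" for i
        using fun_cong[OF eq, of i] by simp
      have "c i = c' i" if "i \<notin> E \<union> E'" for i
        using eq'[of i] that by (simp add: F2_indicator_def)
      then have "hamming_dist c c' \<le> card (E \<union> E')"
        unfolding hamming_dist_def using * S by (intro card_mono) auto
      also have "\<dots> \<le> card E + card E'"
        by (rule card_Un_le)
      finally show False
        using dist[OF *(1,3) \<open>c \<noteq> c'\<close>] S[OF *(2)] S[OF *(4)] by linarith
    qed
    moreover have "E = E'"
      using eq \<open>c = c'\<close> by (simp add: F2_indicator_inject)
    ultimately show "c = c' \<and> E = E'"
      by simp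
  qed
  moreover have "(\<lambda>(c, E). c + F2_indicator E) ` (C \<times> S) \<subseteq> F2_space I"
    using C(1) S(2) by (fastforce simp: F2_space_def F2_indicator_def)
  ultimately have "card (C \<times> S) \<le> card (F2_space I)"
    using finite_F2_space I(1) by (metis card_image card_mono)
  then show ?thesis
    using card_F2_subspace[OF C(2) finC] C(3) cardS I by (simp add: card_cartesian_product card_F2_space)
qed

text \<open>The second Pless power moment: separation of points says that the dual distance is at
  least 3.\<close>

lemma second_power_moment:
  fixes C :: "('i \<Rightarrow> bit) set"
  assumes fin: "finite I" "finite C" and C: "F2_subspace C"
    and sep: "\<And>i j. i \<in> I \<Longrightarrow> j \<in> I \<Longrightarrow> i \<noteq> j \<Longrightarrow> \<exists>c\<in>C. c i \<noteq> c j"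
  shows "(\<Sum>c\<in>C. (\<Sum>i\<in>I. bit_sign (c i))\<^sup>2) = int (card C) * int (card I)"
proof -
  \<comment> \<open>For \<open>i\<close> different from \<open>j\<close>, sending \<open>c\<close>
    to \<open>c i + c j\<close> is additive on \<open>C\<close> and nontrivial by separation, so the
    signs cancel; only the diagonal survives in the moment.\<close>
  have *: "(\<Sum>c\<in>C. bit_sign (c i + c j)) = (if i = j then int (card C) else 0)"
    if ij: "i \<in> I" "j \<in> I" for i j
  proof (cases "i = j")
    case False
    obtain c where c: "c \<in> C" "c i \<noteq> c j"
      using sep[OF ij False] by blast
    then have "c i + c j \<noteq> 0"
      by (cases "c i"; cases "c j") auto
    then have "(\<Sum>c\<in>C. bit_sign (c i + c j)) = 0"
      using C c fin by (intro sum_bit_sign_eq_0[of C _ c]) (auto simp: F2_subspace_iff add_ac)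
    then show ?thesis
      using False by simp
  qed simp
  have "(\<Sum>c\<in>C. (\<Sum>i\<in>I. bit_sign (c i))\<^sup>2) = (\<Sum>c\<in>C. \<Sum>i\<in>I. \<Sum>j\<in>I. bit_sign (c i + c j))"
    by (simp add: power2_eq_square sum_product bit_sign_add)
  also have "\<dots> = (\<Sum>i\<in>I. \<Sum>j\<in>I. \<Sum>c\<in>C. bit_sign (c i + c j))"
    by (subst sum.swap, subst (2) sum.swap) simp
  also have "\<dots> = int (card C) * int (card I)"
    using fin by (simp add: * mult.commute)
  finally show ?thesis .
qed

section \<open>Weights and dual distance of codes containing the all-one word\<close>

lemma sum_bit_sign_eq_weight:
  assumes "finite I" "c \<in> F2_space I"
  shows "(\<Sum>i\<in>I. bit_sign (c i)) = int (card I) - 2 * int (weight c)"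
proof -
  have "{i \<in> I. c i \<noteq> 0} = {i. c i \<noteq> 0}"
    using assms(2) by (auto simp: F2_space_def)
  then show ?thesis
    using sum_bit_sign_eq_card[OF assms(1), of c] by (simp add: weight_def)
qed

lemma sum_F2_word:
  fixes v :: "'i \<Rightarrow> bit"
  assumes "finite I" "v \<in> F2_space I"
  shows "(\<Sum>i\<in>I. v i * c i) = (\<Sum>i | v i = 1. c i)"
proof -
  have "{i. v i = 1} \<subseteq> I"
    using assms(2) by (auto simp: F2_space_def)
  then show ?thesis
    using assms(1) by (intro sum.mono_neutral_cong_right) auto
qed

lemma weight_eq_0_iff:
  assumes "finite I" "c \<in> F2_space I"
  shows "weight c = 0 \<longleftrightarrow> c = 0"
proof -
  have "{i. c i \<noteq> 0} \<subseteq> I"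
    using assms by (auto simp: F2_space_def)
  then have "finite {i. c i \<noteq> 0}"
    using assms finite_subset by blast
  then show ?thesis
    by (auto simp: weight_def fun_eq_iff)
qed

lemma weight_complement:
  assumes "finite I" "c \<in> F2_space I"
  shows "weight c \<le> card I" "weight (F2_indicator I + c) = card I - weight c"
proof -
  have sub: "{i. c i \<noteq> 0} \<subseteq> I"
    using assms by (auto simp: F2_space_def)
  then show "weight c \<le> card I"
    unfolding weight_def using assms by (intro card_mono)
  have "{i. (F2_indicator I + c) i \<noteq> 0} = I - {i. c i \<noteq> 0}"
    using assms by (auto simp: F2_indicator_def F2_space_def)
  then show "weight (F2_indicator I + c) = card I - weight c"
    unfolding weight_def using sub assms by (simp add: card_Diff_subset finite_subset del: bit_not_zero_iff)
qed

text \<open>Adding the all-one word is an involution of \<open>C\<close> that exchanges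
  complementary weights.\<close>

lemma weight_mult_complement:
  assumes fin: "finite I" and C: "C \<subseteq> F2_space I" "F2_subspace C" and ones: "F2_indicator I \<in> C"
    and w: "w \<le> card I"
  shows "weight_mult C (card I - w) = weight_mult C w"
proof -
  let ?h = "(+) (F2_indicator I)"
  have "?h (?h c) = c" for c
    by (simp flip: add.assoc)
  moreover have "?h c \<in> C" "weight c \<le> card I" "weight (?h c) = card I - weight c"
    if "c \<in> C" for c
    using that C ones weight_complement[OF fin subsetD[OF C(1) that]] by (auto simp: F2_subspace_iff)
  ultimately have "bij_betw ?h {c \<in> C. weight c = w} {c \<in> C. weight c = card I - w}"
    using w by (intro bij_betw_byWitness[where f' = ?h]) auto
  then show ?thesis
    unfolding weight_mult_def by (rule bij_betw_same_card[symmetric])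
qed

text \<open>Only the zero word has weight 0, and complementation pairs 0 with \<open>2 * h\<close>
  and \<open>h - t\<close> with \<open>h + t\<close>. Two unknown multiplicities remain; the number
  of codewords and the second moment give two linear equations for them.\<close>

lemma five_weight_distribution:
  assumes fin: "finite I" and C: "C \<subseteq> F2_space I" "F2_subspace C" and ones: "F2_indicator I \<in> C"
    and sep: "\<And>i j. i \<in> I \<Longrightarrow> j \<in> I \<Longrightarrow> i \<noteq> j \<Longrightarrow> \<exists>c\<in>C. c i \<noteq> c j"
    and h: "card I = 2 * h" and t: "0 < t" "t < h"
    and weights: "\<And>c. c \<in> C \<Longrightarrow> weight c \<in> {0, h - t, h, h + t, 2 * h}"
  shows "weight_mult C 0 = 1" "weight_mult C (2 * h) = 1"
    and "weight_mult C (h + t) = weight_mult C (h - t)"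
    and "4 * t\<^sup>2 * weight_mult C (h - t) + 4 * h\<^sup>2 = h * card C"
    and "weight_mult C h + 2 * weight_mult C (h - t) + 2 = card C"
proof -
  let ?N = "weight_mult C"
  have finC: "finite C"
    using C fin finite_F2_space finite_subset by blast
  have "{c \<in> C. weight c = 0} = {0}"
    using C weight_eq_0_iff[OF fin] by (fastforce simp: F2_subspace_iff)
  then show N0: "?N 0 = 1"
    by (simp add: weight_mult_def)
  show N1: "?N (2 * h) = 1"
    using weight_mult_complement[OF fin C ones, of 0] h N0 by simp
  have "2 * h - (h - t) = h + t"
    using t by simp
  then show Nt: "?N (h + t) = ?N (h - t)"
    using weight_mult_complement[OF fin C ones, of "h - t"] h by simp
  have sub: "weight ` C \<subseteq> {0, h - t, h, h + t, 2 * h}"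
    by (rule image_subsetI) (rule weights)
  \<comment> \<open>Used below with the constant 1 and with the squared character sum as functions
    of the weight.\<close>
  have by_weight: "(\<Sum>c\<in>C. \<phi> (weight c)) =
      \<phi> 0 + \<phi> (2 * h) + \<phi> h * int (?N h) + (\<phi> (h - t) + \<phi> (h + t)) * int (?N (h - t))"
    for \<phi> :: "nat \<Rightarrow> int"
  proof -
    have "(\<Sum>c\<in>C. \<phi> (weight c)) =
        (\<Sum>w\<in>{0, h - t, h, h + t, 2 * h}. \<Sum>c\<in>{c \<in> C. weight c = w}. \<phi> (weight c))"
      by (rule sum.group[symmetric, OF finC _ sub]) simp
    also have "\<dots> = (\<Sum>w\<in>{0, h - t, h, h + t, 2 * h}. \<phi> w * int (?N w))"
      by (intro sum.cong refl) (simp add: weight_mult_def mult.commute)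
    also have "\<dots> = \<phi> 0 * int (?N 0) + (\<phi> (h - t) * int (?N (h - t)) + (\<phi> h * int (?N h) +
        (\<phi> (h + t) * int (?N (h + t)) + \<phi> (2 * h) * int (?N (2 * h)))))"
    proof -
      \<comment> \<open>The strict bounds on \<open>t\<close> keep the five weights distinct, so the
        sum splits into five separate terms.\<close>
      have "0 \<notin> {h - t, h, h + t, 2 * h}" "h - t \<notin> {h, h + t, 2 * h}" "h \<notin> {h + t, 2 * h}"
        "h + t \<notin> {2 * h}"
        using t by auto
      then show ?thesis
        by (simp only: sum.insert finite_insert finite.emptyI sum.empty not_False_eq_True add_0_right
            empty_iff)
    qed
    also have "\<dots> = \<phi> 0 + \<phi> (2 * h) + \<phi> h * int (?N h) + (\<phi> (h - t) + \<phi> (h + t)) * int (?N (h - t))"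
      by (simp only: N0 N1 Nt of_nat_1 mult_1_right distrib_right add_ac)
    finally show ?thesis .
  qed
  show "?N h + 2 * ?N (h - t) + 2 = card C"
    using by_weight[of "\<lambda>_. 1"] by simp
  have "(\<Sum>c\<in>C. (2 * int h - 2 * int (weight c))\<^sup>2) = (\<Sum>c\<in>C. (\<Sum>i\<in>I. bit_sign (c i))\<^sup>2)"
    using C h by (intro sum.cong) (auto simp: sum_bit_sign_eq_weight[OF fin])
  also have "\<dots> = int (card C) * (2 * int h)"
    using second_power_moment[OF fin finC C(2) sep] h by simp
  finally have "(\<Sum>c\<in>C. (2 * int h - 2 * int (weight c))\<^sup>2) = int (card C) * (2 * int h)" .
  then have "2 * (2 * int h)\<^sup>2 + 2 * (2 * int t)\<^sup>2 * int (?N (h - t)) = int (card C) * (2 * int h)"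
    using t by (subst (asm) by_weight) (simp add: algebra_simps power2_eq_square)
  then have "int (4 * t\<^sup>2 * ?N (h - t) + 4 * h\<^sup>2) = int (h * card C)"
    by (simp add: algebra_simps power2_eq_square)
  then show "4 * t\<^sup>2 * ?N (h - t) + 4 * h\<^sup>2 = h * card C"
    by (simp only: of_nat_eq_iff)
qed

text \<open>Orthogonality to the all-one word makes the support of \<open>v\<close> even, and a
  support of two points would be a pair of coordinates on which all codewords agree.\<close>

lemma dual_code_weight_ge_4:
  assumes fin: "finite I" and C: "C \<subseteq> F2_space I" and ones: "F2_indicator I \<in> C"
    and sep: "\<And>i j. i \<in> I \<Longrightarrow> j \<in> I \<Longrightarrow> i \<noteq> j \<Longrightarrow> \<exists>c\<in>C. c i \<noteq> c j"
    and v: "v \<in> dual_code I C" "v \<noteq> 0"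
  shows "weight v \<ge> 4"
proof -
  let ?S = "{i. v i = 1}"
  have vI: "v \<in> F2_space I" and orth: "\<And>c. c \<in> C \<Longrightarrow> (\<Sum>i\<in>?S. c i) = 0"
    using v(1) sum_F2_word[OF fin, of v] by (auto simp: dual_code_def)
  have S: "?S \<subseteq> I"
    using vI by (auto simp: F2_space_def)
  have w: "weight v = card ?S"
    by (simp add: weight_def)
  have "(\<Sum>i\<in>?S. F2_indicator I i) = (of_nat (card ?S) :: bit)"
    using S by (simp add: F2_indicator_def subset_iff)
  then have "even (card ?S)"
    using orth[OF ones] by (metis even_of_nat even_zero)
  moreover have "card ?S \<noteq> 0"
    using v(2) vI weight_eq_0_iff[OF fin] w by metis
  moreover have "card ?S \<noteq> 2"
  proof
    assume "card ?S = 2"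
    then obtain i j where ij: "?S = {i, j}" "i \<noteq> j"
      by (auto simp: card_2_iff)
    then obtain c where c: "c \<in> C" "c i \<noteq> c j"
      using sep S by (metis insert_subset)
    then have "c i + c j = 0"
      using orth[OF c(1)] ij by simp
    then show False
      using c(2) by (cases "c i"; cases "c j") auto
  qed
  ultimately show ?thesis
    unfolding w by presburger
qed

text \<open>Sphere packing forbids distance 5 or more for this length and dimension, and the dual
  distance is at least 4; so it equals 4 without a word of weight 4 being exhibited.\<close>

lemma dual_code_distance_optimal:
  assumes fin: "finite I" and n: "card I = n" and C: "C \<subseteq> F2_space I" "F2_subspace C"
    and ones: "F2_indicator I \<in> C"
    and sep: "\<And>i j. i \<in> I \<Longrightarrow> j \<in> I \<Longrightarrow> i \<noteq> j \<Longrightarrow> \<exists>c\<in>C. c i \<noteq> c j"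
    and d: "card C = 2 ^ d" "d < n" and packing: "2 ^ d < 1 + n + (n choose 2)"
  shows "distance_optimal I (dual_code I C) n (n - d) 4"
proof -
  let ?E = "dual_code I C"
  have E: "?E \<subseteq> F2_space I" "F2_subspace ?E"
    using F2_subspace_dual_code by (auto simp: dual_code_def)
  have finE: "finite ?E"
    using E fin finite_F2_space finite_subset by blast
  have pow: "(2 :: nat) ^ n = 2 ^ (n - d) * 2 ^ d"
    using d by (simp flip: power_add)
  then have cardE: "card ?E = 2 ^ (n - d)"
    using card_dual_code[OF fin C] by (simp add: n d)
  \<comment> \<open>Kept general in the coordinate type: it is applied to the dual code itself and
    to the competing codes on \<open>{..<n}\<close>.\<close>
  have no: False if "binary_code J C' n (n - d) d'" "d' \<ge> 5" for J :: "'j set" and C' d'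
  proof -
    have "2 ^ (n - d) * (1 + n + (n choose 2)) \<le> 2 ^ (n - d) * (2 :: nat) ^ d"
      using sphere_packing_radius_2[OF that] by (simp only: pow)
    then have "1 + n + (n choose 2) \<le> 2 ^ d"
      by (rule mult_left_le_imp_le) simp
    then show False
      using packing by simp
  qed
  define w where "w = Min (weight ` (?E - {0}))"
  \<comment> \<open>\<open>d < n\<close> provides a nonzero dual word, so the minimum weight
    exists.\<close>
  have "card ?E > 1"
    unfolding cardE using d by (intro one_less_power) auto
  then have "\<not> ?E \<subseteq> {0}"
    using card_mono[of "{0}" ?E] by fastforce
  then have ne: "weight ` (?E - {0}) \<noteq> {}"
    by auto
  have fin_w: "finite (weight ` (?E - {0}))"
    using finE by simp
  have w: "w \<in> weight ` (?E - {0})"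
    unfolding w_def using fin_w ne by (rule Min_in)
  then obtain v where "v \<in> ?E" "v \<noteq> 0" "weight v = w"
    by auto
  moreover have "w \<le> weight c" if "c \<in> ?E" "c \<noteq> 0" for c
    unfolding w_def using fin_w by (rule Min_le) (use that in auto)
  ultimately have "has_min_dist ?E w"
    unfolding has_min_dist_F2_subspace[OF E(2)] by blast
  then have code: "binary_code I ?E n (n - d) w"
    unfolding binary_code_def using fin n E F2_dim_eqI[OF E(2) finE cardE] by blast
  have "w \<ge> 4"
    using w dual_code_weight_ge_4[OF fin C(1) ones sep] by auto
  moreover have "\<not> w \<ge> 5"
    using no[OF code] by blast
  ultimately have "w = 4"
    by simp
  then show ?thesis
    unfolding distance_optimal_def using code no by auto
qed

section \<open>Traces on finite fields of characteristic 2\<close>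

text \<open>Every fibre over the range is a translate of the kernel.\<close>

lemma card_range_kernel:
  fixes h :: "'b::{finite, ab_group_add} \<Rightarrow> 'c::ab_group_add"
  assumes add: "\<And>x y. h (x + y) = h x + h y"
  shows "card (UNIV :: 'b set) = card (range h) * card {x. h x = 0}"
proof -
  have "card {x. h x = y} = card {x. h x = 0}" if y: "y \<in> range h" for y
  proof -
    obtain z where z: "y = h z"
      using y by blast
    have "{x. h x = y} = (+) z ` {x. h x = 0}"
    proof (intro equalityI subsetI)
      fix x assume "x \<in> {x. h x = y}"
      moreover have "h x = h z + h (x - z)"
        by (simp flip: add)
      ultimately show "x \<in> (+) z ` {x. h x = 0}"
        using z by (intro image_eqI[where x = "x - z"]) auto
    qed (auto simp: z add)
    then show ?thesis
      by (simp add: card_image)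
  qed
  then show ?thesis
    using sum.image_gen[of UNIV "\<lambda>_. 1 :: nat" h] by simp
qed

section \<open>Frobenius powers, their fixed fields and relative traces\<close>

locale binary_field =
  fixes m :: nat and type :: "'a::finite_field itself"
  assumes card_UNIV: "card (UNIV :: 'a set) = 2 ^ m"
begin

lemma m_pos: "m > 0"
proof (rule ccontr)
  assume "\<not> m > 0"
  then have "card (UNIV :: 'a set) = 1"
    using card_UNIV by simp
  then have "(0 :: 'a) = 1"
    by (metis UNIV_I card_1_singletonE singletonD)
  then show False
    by simp
qed

lemma power_2_m: "(x :: 'a) ^ 2 ^ m = x"
  using finite_field_power_card_eq_same[of x] by (simp add: card_UNIV)

lemma CHAR_eq_2: "CHAR('a) = 2"
proof -
  \<comment> \<open>The exponent \<open>2 ^ m\<close> is even because \<open>m > 0\<close>, yet this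
    power fixes -1.\<close>
  have "(- 1 :: 'a) = 1"
    using power_2_m[of "- 1"] m_pos by simp
  then have "of_nat 2 = (0 :: 'a)"
    by (metis of_nat_numeral one_add_one add.right_inverse)
  then have "CHAR('a) dvd 2"
    by (simp only: of_nat_eq_0_iff_char_dvd)
  then show ?thesis
    using CHAR_prime[where ?'a = 'a] two_is_prime_nat primes_dvd_imp_eq by blast
qed

lemma of_nat_eq: "of_nat n = (of_bool (odd n) :: 'a)"
proof -
  have "of_nat 2 = (0 :: 'a)"
    unfolding CHAR_eq_2[symmetric] by (rule of_nat_CHAR)
  then show ?thesis
    by (cases "even n") (auto elim!: evenE oddE)
qed

lemma add_self [simp]: "x + x = (0 :: 'a)"
  using of_nat_eq[of 2] by (simp flip: mult_2)

lemma add_eq_0_iff: "x + y = 0 \<longleftrightarrow> x = (y :: 'a)"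
  by (metis add_self add_right_cancel)

lemma power_2_add: "(x + y :: 'a) ^ 2 ^ j = x ^ 2 ^ j + y ^ 2 ^ j"
  by (rule freshmans_dream'[where n = j]) (simp_all add: CHAR_eq_2)

lemma power_2_sum: "sum h A ^ 2 ^ j = (\<Sum>i\<in>A. h i ^ 2 ^ j :: 'a)"
  by (rule freshmans_dream_sum'[where n = j]) (simp_all add: CHAR_eq_2)

lemma power_2_power_2: "((x :: 'a) ^ 2 ^ i) ^ 2 ^ j = x ^ 2 ^ (i + j)"
  by (simp add: power_add flip: power_mult)

lemma power_2_inject: "(x :: 'a) ^ 2 ^ j = y ^ 2 ^ j \<longleftrightarrow> x = y"
proof
  assume "x ^ 2 ^ j = y ^ 2 ^ j"
  then have "(x + y) ^ 2 ^ j = 0"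
    by (simp add: power_2_add)
  then show "x = y"
    by (simp add: add_eq_0_iff)
qed simp

definition frob_fixed :: "nat \<Rightarrow> 'a set" where
  "frob_fixed d = {x. x ^ 2 ^ d = x}"

lemma frob_fixed_mono:
  assumes "d dvd e"
  shows "frob_fixed d \<subseteq> frob_fixed e"
proof
  fix x assume x: "x \<in> frob_fixed d"
  obtain j where "e = d * j"
    using assms by blast
  moreover have "x ^ 2 ^ (d * i) = x" for i
  proof (induction i)
    case (Suc i)
    have "x ^ 2 ^ (d * Suc i) = (x ^ 2 ^ d) ^ 2 ^ (d * i)"
      by (simp add: power_2_power_2)
    then show ?case
      using x Suc by (simp add: frob_fixed_def)
  qed simp
  ultimately show "x \<in> frob_fixed e"
    by (simp add: frob_fixed_def)
qed

lemma frob_fixedD: "x \<in> frob_fixed d \<Longrightarrow> d dvd e \<Longrightarrow> x ^ 2 ^ e = x"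
  using frob_fixed_mono by (auto simp: frob_fixed_def)

lemma frob_fixed_simps:
  "0 \<in> frob_fixed d" "1 \<in> frob_fixed d"
  "x \<in> frob_fixed d \<Longrightarrow> y \<in> frob_fixed d \<Longrightarrow> x + y \<in> frob_fixed d"
  "x \<in> frob_fixed d \<Longrightarrow> inverse x \<in> frob_fixed d"
  by (auto simp: frob_fixed_def power_2_add power_inverse)

lemma rel_trace_add: "rel_trace m d (x + y :: 'a) = rel_trace m d x + rel_trace m d y"
  by (simp add: rel_trace_def power_2_add sum.distrib)

text \<open>One step of the \<open>d\<close>-th Frobenius power shifts the summands cyclically, the
  last one returning to \<open>x\<close> by \<open>power_2_m\<close>.\<close>

lemma rel_trace_frob:
  assumes "d dvd m" "d dvd e"
  shows "rel_trace m d ((x :: 'a) ^ 2 ^ e) = rel_trace m d x"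
proof -
  have "rel_trace m d (x ^ 2 ^ d) = rel_trace m d x" for x :: 'a
  proof -
    let ?g = "\<lambda>i. x ^ 2 ^ (d * i)"
    have "rel_trace m d (x ^ 2 ^ d) = (\<Sum>i<m div d. ?g (Suc i))"
      by (simp add: rel_trace_def power_2_power_2)
    moreover have "?g 0 + (\<Sum>i<m div d. ?g (Suc i)) = (\<Sum>i<m div d. ?g i) + ?g (m div d)"
      using sum.lessThan_Suc[of ?g "m div d"] sum.lessThan_Suc_shift[of ?g "m div d"] by simp
    moreover have "?g (m div d) = ?g 0"
      using assms by (simp add: power_2_m)
    ultimately show ?thesis
      by (simp add: rel_trace_def)
  qed
  note step = this
  obtain j where "e = d * j"
    using assms by blast
  moreover have "rel_trace m d (x ^ 2 ^ (d * i)) = rel_trace m d x" for i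
  proof (induction i)
    case (Suc i)
    have "rel_trace m d (x ^ 2 ^ (d * Suc i)) = rel_trace m d ((x ^ 2 ^ (d * i)) ^ 2 ^ d)"
      by (simp add: power_2_power_2 add.commute)
    then show ?case
      using Suc step by simp
  qed simp
  ultimately show ?thesis
    by simp
qed

lemma rel_trace_in_frob_fixed:
  assumes "d dvd m"
  shows "rel_trace m d (x :: 'a) \<in> frob_fixed d"
proof -
  have "rel_trace m d x ^ 2 ^ d = rel_trace m d (x ^ 2 ^ d)"
    by (simp add: rel_trace_def power_2_sum power_2_power_2 add.commute)
  then show ?thesis
    using rel_trace_frob[OF assms, of d x] by (simp add: frob_fixed_def)
qed

lemma rel_trace_of_fixed:
  "x \<in> frob_fixed d \<Longrightarrow> rel_trace m d x = of_bool (odd (m div d)) * x"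
  by (simp add: rel_trace_def frob_fixedD flip: of_nat_eq)

text \<open>The elements are the roots of X^(2^d) - X, which is nonzero since its linear coefficient
  is -1 for positive \<open>d\<close>.\<close>

lemma card_frob_fixed_le:
  assumes "d > 0"
  shows "card (frob_fixed d) \<le> 2 ^ d"
proof -
  let ?p = "monom 1 (2 ^ d) - monom (1 :: 'a) 1"
  have "coeff ?p 1 = - 1"
    using assms by simp
  then have "?p \<noteq> 0"
    by (metis coeff_0 neg_equal_0_iff_equal zero_neq_one)
  then have "card {x. poly ?p x = 0} \<le> degree ?p"
    by (rule card_poly_roots_bound)
  also have "\<dots> \<le> 2 ^ d"
    by (intro degree_diff_le) (simp_all add: degree_monom_eq)
  finally show ?thesis
    by (simp add: frob_fixed_def poly_monom)
qed

text \<open>The kernel consists of the roots of the trace polynomial, whose linear coefficient is 1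
  and whose exponents are at most \<open>2 ^ (m - d)\<close>.\<close>

lemma card_rel_trace_kernel_le:
  assumes "d > 0" "d dvd m"
  shows "card {x :: 'a. rel_trace m d x = 0} \<le> 2 ^ (m - d)"
proof -
  let ?p = "\<Sum>i<m div d. monom (1 :: 'a) (2 ^ (d * i))"
  have "d \<le> m" "m div d > 0"
    using assms m_pos dvd_imp_le by (auto simp: div_greater_zero_iff)
  have "coeff ?p 1 = (\<Sum>i<m div d. if i = 0 then 1 else 0)"
    unfolding coeff_sum using assms by (intro sum.cong) auto
  then have "coeff ?p 1 = 1"
    using \<open>m div d > 0\<close> by simp
  then have "?p \<noteq> 0"
    by (metis coeff_0 zero_neq_one)
  then have "card {x. poly ?p x = 0} \<le> degree ?p"
    by (rule card_poly_roots_bound)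
  also have "\<dots> \<le> 2 ^ (m - d)"
  proof (intro degree_sum_le)
    fix i assume "i \<in> {..<m div d}"
    then have "d * i + d \<le> d * (m div d)"
      by (metis lessThan_iff Suc_leI mult_Suc_right add.commute mult_le_mono2)
    then have "d * i \<le> m - d"
      using assms by simp
    then show "degree (monom (1 :: 'a) (2 ^ (d * i))) \<le> 2 ^ (m - d)"
      by (simp add: degree_monom_eq)
  qed simp
  finally show ?thesis
    by (simp add: rel_trace_def poly_sum poly_monom)
qed

text \<open>Counting closes the loop: the root bounds on the kernels of \<open>x \<mapsto> x\<^bsup>2^d\<^esup> + x\<close> and of the
  trace multiply to \<open>2\<^sup>m\<close>, and the trace vanishes on the image of the former map.\<close>

lemma
  assumes d: "d > 0" "d dvd m"
  shows card_frob_fixed: "card (frob_fixed d) = 2 ^ d"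
    and range_rel_trace: "range (rel_trace m d) = frob_fixed d"
    and rel_trace_kernel: "{x. rel_trace m d x = 0} = range (\<lambda>u :: 'a. u ^ 2 ^ d + u)"
proof -
  let ?h = "\<lambda>u :: 'a. u ^ 2 ^ d + u" and ?T = "rel_trace m d :: 'a \<Rightarrow> 'a"
  have le: "d \<le> m"
    using d m_pos dvd_imp_le by blast
  have "(2 :: nat) ^ m = card (range ?h) * card {x. ?h x = 0}"
    by (subst card_range_kernel[symmetric]) (auto simp: card_UNIV power_2_add algebra_simps)
  then have 1: "(2 :: nat) ^ m = card (range ?h) * card (frob_fixed d)"
    by (simp add: frob_fixed_def add_eq_0_iff)
  have "card (UNIV :: 'a set) = card (range ?T) * card {x. ?T x = 0}"
    by (rule card_range_kernel) (rule rel_trace_add)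
  then have 2: "(2 :: nat) ^ m = card (range ?T) * card {x. ?T x = 0}"
    by (simp add: card_UNIV)
  have sub: "range ?h \<subseteq> {x. ?T x = 0}"
    using d by (auto simp: rel_trace_add rel_trace_frob)
  then have le1: "card (range ?h) \<le> card {x. ?T x = 0}"
    by (intro card_mono) auto
  have le2: "card {x. ?T x = 0} \<le> 2 ^ (m - d)" and le3: "card (frob_fixed d) \<le> 2 ^ d"
    using card_rel_trace_kernel_le[OF d] card_frob_fixed_le d by auto
  have pow: "(2 :: nat) ^ m = 2 ^ (m - d) * 2 ^ d"
    using le by (simp flip: power_add)
  have "2 ^ (m - d) * 2 ^ d \<le> card (range ?h) * (2 :: nat) ^ d"
    using 1 le3 by (simp add: pow)
  then have *: "card (range ?h) = 2 ^ (m - d)" "card {x. ?T x = 0} = 2 ^ (m - d)"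
    using le1 le2 by auto
  then show card: "card (frob_fixed d) = 2 ^ d"
    using 1 by (simp add: pow)
  show "{x. ?T x = 0} = range ?h"
    using sub * by (intro card_subset_eq[symmetric]) auto
  have "card (range ?T) = 2 ^ d"
    using 2 * by (simp add: pow)
  then show "range ?T = frob_fixed d"
    using card rel_trace_in_frob_fixed d by (intro card_subset_eq) auto
qed

lemma frob_fixed_1: "frob_fixed 1 = {0, 1}"
proof (rule card_subset_eq[symmetric])
  show "card {0, 1 :: 'a} = card (frob_fixed 1)"
    by (subst card_frob_fixed) auto
qed (auto simp: frob_fixed_simps)

section \<open>The absolute trace as an additive character\<close>

abbreviation Tr :: "'a \<Rightarrow> bit" where
  "Tr \<equiv> abs_trace m"

lemma rel_trace_1_cases: "rel_trace m 1 (x :: 'a) \<in> {0, 1}"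
  using rel_trace_in_frob_fixed[of 1 x] by (simp only: frob_fixed_1 one_dvd)

lemma Tr_add: "Tr (x + y) = Tr x + Tr y"
  using rel_trace_1_cases[of x] rel_trace_1_cases[of y] by (auto simp: abs_trace_def rel_trace_add)

lemma Tr_0 [simp]: "Tr 0 = 0"
  using Tr_add[of 0 0] by simp

lemma Tr_sum: "finite A \<Longrightarrow> Tr (sum h A) = (\<Sum>i\<in>A. Tr (h i))"
  by (induction A rule: finite_induct) (auto simp: Tr_add)

lemma Tr_frob: "Tr (x ^ 2 ^ j) = Tr x"
  using rel_trace_frob[of 1 j x] by (simp add: abs_trace_def)

lemma ex_Tr_eq_1: "\<exists>x. Tr x = 1"
proof -
  have "1 \<in> range (rel_trace m 1 :: 'a \<Rightarrow> 'a)"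
    using range_rel_trace[of 1] frob_fixed_simps(2) by simp
  then obtain x :: 'a where "rel_trace m 1 x = 1"
    by (metis rangeE)
  then show ?thesis
    by (intro exI[of _ x]) (simp add: abs_trace_def)
qed

lemma Tr_nondegenerate:
  assumes "c \<noteq> 0"
  shows "\<exists>x. Tr (c * x) = 1"
proof -
  obtain z where "Tr z = 1"
    using ex_Tr_eq_1 by blast
  then show ?thesis
    using assms by (intro exI[of _ "z / c"]) simp
qed

text \<open>Inside \<open>Tr\<close>, a suitable Frobenius power moves the exponent from
  \<open>y\<close> to \<open>a\<close>. This lets the coefficient \<open>a\<close> of the Gold form
  be replaced by its relative trace.\<close>

lemma Tr_rel_trace_adjoint:
  assumes "d dvd m"
  shows "Tr (a * rel_trace m d y) = Tr (rel_trace m d a * y)"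
proof -
  let ?s = "m div d"
  \<comment> \<open>Undoing exponent \<open>d * i\<close> takes the exponents on \<open>a\<close>
    from \<open>d\<close> up to \<open>m\<close> instead of from 0. They sum to the trace of the
    \<open>2 ^ d\<close>-th power of \<open>a\<close>, which equals that of
    \<open>a\<close>.\<close>
  let ?g = "\<lambda>i. Tr (a ^ 2 ^ (d * Suc i) * y)"
  have "Tr (a * y ^ 2 ^ (d * i)) = ?g (?s - Suc i)" if "i < ?s" for i
  proof -
    have "i + Suc (?s - Suc i) = ?s"
      using that by simp
    then have "d * i + d * Suc (?s - Suc i) = d * ?s"
      by (metis add_mult_distrib2)
    then have "(a * y ^ 2 ^ (d * i)) ^ 2 ^ (d * Suc (?s - Suc i)) = a ^ 2 ^ (d * Suc (?s - Suc i)) * y"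
      using assms by (simp add: power_mult_distrib power_2_power_2 power_2_m del: mult_Suc_right)
    then show ?thesis
      by (metis Tr_frob)
  qed
  then have "Tr (a * rel_trace m d y) = (\<Sum>i<?s. ?g (?s - Suc i))"
    by (simp add: rel_trace_def sum_distrib_left Tr_sum)
  also have "\<dots> = (\<Sum>i<?s. ?g i)"
    by (rule sum.nat_diff_reindex)
  also have "\<dots> = Tr (rel_trace m d (a ^ 2 ^ d) * y)"
    by (simp add: rel_trace_def sum_distrib_right Tr_sum power_2_power_2)
  also have "rel_trace m d (a ^ 2 ^ d) = rel_trace m d a"
    using assms by (intro rel_trace_frob) auto
  finally show ?thesis .
qed

text \<open>All \<open>m div d\<close> summands have the absolute trace of \<open>x\<close>. The
  parity thus decides whether \<open>Tr\<close> vanishes on the subfield of order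
  \<open>2 ^ d\<close>.\<close>

lemma Tr_rel_trace:
  assumes "d dvd m"
  shows "Tr (rel_trace m d x) = of_bool (odd (m div d)) * Tr x"
proof -
  have "Tr (rel_trace m d x) = of_nat (m div d) * Tr x"
    by (simp add: rel_trace_def Tr_sum Tr_frob)
  also have "of_nat (m div d) = (of_bool (odd (m div d)) :: bit)"
    by (cases "even (m div d)") (auto elim!: evenE oddE)
  finally show ?thesis .
qed

subsection \<open>Quadratic character sums over the hyperplane of trace 1\<close>

lemma trace_one_set_eq: "trace_one_set m = {x. Tr x = 1}"
  by (auto simp: trace_one_set_def)

lemma card_Tr_fibre: "card {x. Tr x = 0} = 2 ^ (m - 1)" "card {x. Tr x = 1} = 2 ^ (m - 1)"
proof -
  obtain z where z: "Tr z = 1"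
    using ex_Tr_eq_1 by blast
  have "2 * card {x \<in> UNIV. Tr x = 0} = card (UNIV :: 'a set)"
    "2 * card {x \<in> UNIV. Tr x = 1} = card (UNIV :: 'a set)"
    by (rule card_additive_kernel[of _ _ z]; simp add: Tr_add z)+
  moreover have "(2 :: nat) ^ m = 2 * 2 ^ (m - 1)"
    using m_pos by (simp flip: power_Suc)
  ultimately show "card {x. Tr x = 0} = 2 ^ (m - 1)" "card {x. Tr x = 1} = 2 ^ (m - 1)"
    by (simp_all add: card_UNIV)
qed

text \<open>The indicator of \<open>Tr y = 1\<close> is half of 1 minus the sign of
  \<open>Tr y\<close>, so twice the sum is the difference of the full character sums at
  \<open>c\<close> and \<open>c + 1\<close>; both vanish unless \<open>c\<close> is 0 or 1.\<close>

lemma sum_trace_one_character: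
  "(\<Sum>y | Tr y = 1. bit_sign (Tr (c * y))) =
    (if c = 0 then 2 ^ (m - 1) else if c = 1 then - (2 ^ (m - 1)) else 0)"
proof -
  have full: "(\<Sum>y\<in>UNIV. bit_sign (Tr (c * y))) = 0" if c: "c \<noteq> 0" for c
  proof -
    obtain u where "Tr (c * u) = 1"
      using Tr_nondegenerate[OF c] by blast
    then show ?thesis
      by (intro sum_bit_sign_eq_0[of _ _ u]) (auto simp: distrib_left Tr_add)
  qed
  consider "c = 0" | "c = 1" | "c \<noteq> 0" "c + 1 \<noteq> 0"
    using add_eq_0_iff by blast
  then show ?thesis
  proof cases
    case 3
    have "bit_sign (Tr (c * y)) - bit_sign (Tr ((c + 1) * y)) =
        2 * (if Tr y = 1 then bit_sign (Tr (c * y)) else 0)" for y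
      by (cases "Tr y") (simp_all add: distrib_right Tr_add bit_sign_add)
    then have "2 * (\<Sum>y | Tr y = 1. bit_sign (Tr (c * y))) =
        (\<Sum>y\<in>UNIV. bit_sign (Tr (c * y)) - bit_sign (Tr ((c + 1) * y)))"
      by (simp add: sum.If_cases flip: sum_distrib_left)
    also have "\<dots> = 0"
      using 3 by (simp add: sum_subtractf full)
    finally show ?thesis
      using 3 by (auto simp: add_eq_0_iff)
  qed (simp_all add: card_Tr_fibre)
qed

text \<open>Squaring a quadratic character sum over the affine hyperplane \<open>Tr x = 1\<close> and summing first
  over the base point leaves only the directions \<open>u\<close> with \<open>L u \<in> {0, 1}\<close>, on which the phase is
  additive.\<close>

lemma trace_one_quadratic_sum_square:
  assumes polar: "\<And>x y. g (x + y) = g x + g y + Tr (L x * y)"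
    and L: "\<And>x y. L (x + y) = L x + L y"
  shows "(\<Sum>x | Tr x = 1. bit_sign (g x))\<^sup>2 \<in>
    {0, 2 ^ (m - 1) * int (card {u. Tr u = 0 \<and> L u \<in> {0, 1}})}"
proof -
  let ?D = "{x. Tr x = 1}" and ?U = "{u. Tr u = 0 \<and> L u \<in> {0, 1}}"
  \<comment> \<open>For \<open>L u = 1\<close> the inner sum over the hyperplane is
    \<open>- (2 ^ (m - 1))\<close>; the extra summand of \<open>h\<close> absorbs this sign.\<close>
  define h where "h = (\<lambda>u. g u + (if L u = 0 then 0 else 1))"
  have L0: "L 0 = 0"
    using L[of 0 0] by simp
  have "(\<Sum>x\<in>?D. bit_sign (g x))\<^sup>2 = (\<Sum>y\<in>?D. \<Sum>x\<in>?D. bit_sign (g x + g y))"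
    by (simp add: power2_eq_square sum_product bit_sign_add mult.commute)
  also have "\<dots> = (\<Sum>y\<in>?D. \<Sum>u | Tr u = 0. bit_sign (g u) * bit_sign (Tr (L u * y)))"
  proof (rule sum.cong[OF refl])
    fix y assume y: "y \<in> ?D"
    have "bit_sign (g u) * bit_sign (Tr (L u * y)) = bit_sign (g (u + y) + g y)" for u
      by (simp add: polar bit_sign_add mult_ac)
    then show "(\<Sum>x\<in>?D. bit_sign (g x + g y)) =
        (\<Sum>u | Tr u = 0. bit_sign (g u) * bit_sign (Tr (L u * y)))"
      using y by (intro sum.reindex_bij_witness[of _ "\<lambda>u. u + y" "\<lambda>x. x + y"])
        (auto simp: Tr_add add.assoc)
  qed
  also have "\<dots> = (\<Sum>u | Tr u = 0. bit_sign (g u) * (\<Sum>y\<in>?D. bit_sign (Tr (L u * y))))"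
    by (subst sum.swap) (simp add: sum_distrib_left)
  also have "\<dots> = (\<Sum>u\<in>?U. bit_sign (g u) * (\<Sum>y\<in>?D. bit_sign (Tr (L u * y))))"
    by (intro sum.mono_neutral_right) (auto simp: sum_trace_one_character)
  also have "\<dots> = 2 ^ (m - 1) * (\<Sum>u\<in>?U. bit_sign (h u))"
    unfolding sum_distrib_left
    by (intro sum.cong) (auto simp: sum_trace_one_character card_Tr_fibre h_def bit_sign_add)
  finally have "(\<Sum>x\<in>?D. bit_sign (g x))\<^sup>2 = 2 ^ (m - 1) * (\<Sum>u\<in>?U. bit_sign (h u))" .
  moreover have "(\<Sum>u\<in>?U. bit_sign (h u)) \<in> {0, int (card ?U)}"
  proof (rule sum_bit_sign_cases)
    \<comment> \<open>The polar term \<open>Tr (L u * v)\<close> vanishes since \<open>L u\<close>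
      is 0 or 1 and \<open>Tr v = 0\<close>; the correction is additive because \<open>L\<close>
      is.\<close>
    show "h (u + v) = h u + h v" if "u \<in> ?U" "v \<in> ?U" for u v
      using that by (auto simp: h_def polar L add_ac)
  qed (auto simp: Tr_add L)
  ultimately show ?thesis
    by auto
qed

text \<open>Polarising at \<open>x = y = u\<close> leaves only this term in characteristic 2.
  Wherever \<open>L u = 1\<close> it yields \<open>Tr u = 0\<close>.\<close>

lemma Tr_polar_self:
  assumes polar: "\<And>x y. g (x + y) = g x + g y + Tr (L x * y)"
  shows "Tr (L u * u) = 0"
proof -
  have "g 0 = 0"
    using polar[of 0 0] by simp
  then show ?thesis
    using polar[of u u] by simp
qed

end

section \<open>The code of the Gold form\<close>

lemma two_power_pred:
  assumes "m \<ge> 2"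
  shows "2 ^ (m - 1) = 2 * (2 :: nat) ^ (m - 2)"
  using assms by (simp add: Suc_diff_Suc numeral_2_eq_2 flip: power_Suc)

text \<open>Since \<open>multiplicity 2 m\<close> exceeds \<open>multiplicity 2 k\<close> by
  \<open>multiplicity 2 s\<close>, the three cases are \<open>s\<close> odd, \<open>s\<close> twice
  an odd number, and \<open>4 dvd s\<close>. In each the numerator of the exponent is even, so the
  halving is exact.\<close>

lemma amplitude_exponent:
  fixes m k s t :: nat
  assumes m: "m = k * s" "m \<ge> 4" and k: "k > 0" and s: "s \<ge> 3"
    and t1: "multiplicity 2 m > multiplicity 2 k + 1 \<Longrightarrow> t = 2 ^ ((m + 2 * k - 2) div 2)"
    and t2: "multiplicity 2 m = multiplicity 2 k + 1 \<Longrightarrow> t = 2 ^ ((m + 2 * k - 4) div 2)"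
    and t3: "multiplicity 2 m = multiplicity 2 k \<Longrightarrow> t = 2 ^ ((m + k - 4) div 2)"
  shows "\<exists>e. t = 2 ^ e \<and>
     (odd s \<and> m + k = 2 * e + 4 \<or> (\<exists>j. s = 2 * j \<and> odd j) \<and> m + 2 * k = 2 * e + 4 \<or>
      4 dvd s \<and> m + 2 * k = 2 * e + 2)"
proof -
  have mult: "multiplicity 2 m = multiplicity 2 k + multiplicity 2 s"
    unfolding m(1) using k s by (intro prime_elem_multiplicity_mult_distrib) auto
  have exponent: "\<exists>e. t = 2 ^ e \<and> c = 2 * e + d"
    if "t = 2 ^ ((c - d) div 2)" "even c" "even d" "d \<le> c" for c d
    using that by (intro exI[of _ "(c - d) div 2"]) auto
  consider "odd s" | j where "s = 2 * j" "odd j" | "4 dvd s"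
  proof (cases "even s")
    case True
    then obtain j where "s = 2 * j"
      by blast
    then show ?thesis
      using that by (cases "even j") auto
  qed (use that in blast)
  then show ?thesis
  proof cases
    case 1
    then have "multiplicity 2 m = multiplicity 2 k"
      using mult not_dvd_imp_multiplicity_0 by simp
    then show ?thesis
      using exponent[of "m + k" 4, OF t3] 1 m by auto
  next
    case (2 j)
    have "multiplicity 2 s = 1"
      using 2 odd_pos[of j] multiplicity_times_same[where p = 2 and x = j] not_dvd_imp_multiplicity_0[of 2 j] by simp
    then have "multiplicity 2 m = multiplicity 2 k + 1"
      using mult by simp
    moreover have "even m"
      using 2 m(1) by simp
    ultimately obtain e where "t = 2 ^ e" "m + 2 * k = 2 * e + 4"
      using exponent[of "m + 2 * k" 4, OF t2] m(2) by auto
    then show ?thesis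
      using 2 by blast
  next
    case 3
    have "\<not> is_unit (2 :: nat)"
      by simp
    then have "multiplicity 2 s \<ge> 2"
      using 3 s by (intro multiplicity_geI) auto
    then have "multiplicity 2 m > multiplicity 2 k + 1"
      using mult by simp
    moreover have "even m"
      using 3 m by (metis dvd_mult dvd_trans even_numeral)
    ultimately show ?thesis
      using exponent[of "m + 2 * k" 2, OF t1] 3 m by auto
  qed
qed

section \<open>The polar form of the Gold function and its directions\<close>

locale binary_field_extension = binary_field m type
  for m :: nat and type :: "'a::finite_field itself" +
  fixes k s :: nat
  assumes k_pos: "k > 0" and m_eq: "m = k * s"
begin

lemma s_pos: "s > 0"
  using m_pos m_eq by simp

text \<open>The linearised polynomial of the polar form of
  \<open>Tr (\<beta> * x ^ (2 ^ k + 1))\<close> for \<open>\<beta>\<close> in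
  \<open>frob_fixed k\<close>. The power \<open>2 ^ (m - k)\<close> inverts the power
  \<open>2 ^ k\<close>.\<close>

definition polar_map :: "'a \<Rightarrow> 'a \<Rightarrow> 'a" where
  "polar_map \<beta> u = \<beta> * (u ^ 2 ^ k + u ^ 2 ^ (m - k))"

lemma polar_map_add: "polar_map \<beta> (x + y) = polar_map \<beta> x + polar_map \<beta> y"
  by (simp add: polar_map_def power_2_add algebra_simps)

text \<open>Of the two cross terms, the one with \<open>y ^ 2 ^ k\<close> is raised to the power
  \<open>2 ^ (m - k)\<close> under the trace to free \<open>y\<close>. This fixes
  \<open>\<beta>\<close> because \<open>k dvd m - k\<close>.\<close>

lemma gold_polar:
  assumes "\<beta> \<in> frob_fixed k"
  shows "Tr (\<beta> * (x + y) ^ (2 ^ k + 1) + b * (x + y)) =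
    Tr (\<beta> * x ^ (2 ^ k + 1) + b * x) + Tr (\<beta> * y ^ (2 ^ k + 1) + b * y) +
    Tr (polar_map \<beta> x * y)"
proof -
  have k_le: "k \<le> m" and dvd: "k dvd m - k"
    using m_eq s_pos by (auto intro: dvd_diff_nat)
  have "(\<beta> * (x * y ^ 2 ^ k)) ^ 2 ^ (m - k) = \<beta> * (x ^ 2 ^ (m - k) * y)"
    using k_le frob_fixedD[OF assms dvd] by (simp add: power_mult_distrib power_2_power_2 power_2_m)
  then have "Tr (\<beta> * (x * y ^ 2 ^ k)) = Tr (\<beta> * (x ^ 2 ^ (m - k) * y))"
    by (metis Tr_frob)
  then show ?thesis
    by (simp add: power_add power_2_add polar_map_def algebra_simps Tr_add)
qed

text \<open>Raise \<open>polar_map \<beta> u = c\<close> to the power \<open>2\<^sup>k\<close>.\<close>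

lemma polar_map_eq_iff:
  assumes "\<beta> \<in> frob_fixed k" "\<beta> \<noteq> 0" "c \<in> frob_fixed k"
  shows "polar_map \<beta> u = c \<longleftrightarrow> u ^ 2 ^ (2 * k) + u = c * inverse \<beta>"
proof -
  have "k \<le> m"
    using m_eq s_pos by simp
  have "polar_map \<beta> u = c \<longleftrightarrow> polar_map \<beta> u ^ 2 ^ k = c ^ 2 ^ k"
    by (simp only: power_2_inject)
  also have "polar_map \<beta> u ^ 2 ^ k = \<beta> * (u ^ 2 ^ (2 * k) + u)"
    using assms \<open>k \<le> m\<close>
    by (simp add: polar_map_def power_mult_distrib power_2_add power_2_power_2 power_2_m
        frob_fixed_def mult_2)
  also have "c ^ 2 ^ k = c"
    using assms by (simp add: frob_fixed_def)
  finally show ?thesis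
    using assms(2) by (auto simp: field_simps)
qed

text \<open>For \<open>s = 2 * j + 1\<close>, \<open>m\<close> is \<open>k\<close> plus a multiple
  of \<open>2 * k\<close>, so on these elements the identity \<open>x ^ 2 ^ m = x\<close> reduces to
  \<open>x ^ 2 ^ k = x\<close>.\<close>

lemma frob_fixed_double:
  assumes "odd s"
  shows "frob_fixed (2 * k) = frob_fixed k"
proof (intro equalityI subsetI)
  fix x assume x: "x \<in> frob_fixed (2 * k)"
  obtain j where j: "s = 2 * j + 1"
    using assms by (elim oddE)
  have "x ^ 2 ^ k = (x ^ 2 ^ (2 * k * j)) ^ 2 ^ k"
    using frob_fixedD[OF x, of "2 * k * j"] by simp
  also have "\<dots> = x ^ 2 ^ m"
    by (simp add: power_2_power_2 m_eq j algebra_simps)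
  finally show "x \<in> frob_fixed k"
    by (simp add: power_2_m frob_fixed_def)
qed (use frob_fixed_mono[of k "2 * k"] in auto)

text \<open>Used with \<open>r = k\<close> for odd \<open>s\<close> and \<open>r = 2 * k\<close> for
  \<open>s\<close> twice an odd number. The value 1 is not attained: the trace to the subfield of
  order \<open>2 ^ r\<close> would give 0 = \<open>inverse \<beta>\<close>, as
  \<open>m div r\<close> is odd. The zeros form that subfield, and \<open>Tr\<close> is nontrivial
  on it for the same reason, which leaves half of it.\<close>

lemma polar_map_directions_odd:
  assumes \<beta>: "\<beta> \<in> frob_fixed k" "\<beta> \<noteq> 0"
    and r: "r > 0" "r dvd m" "k dvd r" "r dvd 2 * k" "odd (m div r)" 
    and W: "frob_fixed (2 * k) = frob_fixed r"
  shows "card {u. Tr u = 0 \<and> polar_map \<beta> u \<in> {0, 1}} = 2 ^ (r - 1)"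
proof -
  have "polar_map \<beta> u \<noteq> 1" for u
  proof
    assume "polar_map \<beta> u = 1"
    then have "u ^ 2 ^ (2 * k) + u = inverse \<beta>"
      using \<beta> frob_fixed_simps(2) by (simp add: polar_map_eq_iff)
    then have "rel_trace m r (inverse \<beta>) = rel_trace m r (u ^ 2 ^ (2 * k)) + rel_trace m r u"
      by (metis rel_trace_add)
    then have "rel_trace m r (inverse \<beta>) = 0"
      using r by (simp add: rel_trace_frob)
    moreover have "inverse \<beta> \<in> frob_fixed r"
      using \<beta> frob_fixed_simps(4) frob_fixed_mono[OF r(3)] by blast
    ultimately show False
      using r \<beta> by (simp add: rel_trace_of_fixed)
  qed
  moreover have "polar_map \<beta> u = 0 \<longleftrightarrow> u \<in> frob_fixed r" for u
    using \<beta> frob_fixed_simps(1)[of k] unfolding W[symmetric]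
    by (simp add: polar_map_eq_iff add_eq_0_iff frob_fixed_def)
  ultimately have U: "{u. Tr u = 0 \<and> polar_map \<beta> u \<in> {0, 1}} = {u \<in> frob_fixed r. Tr u = 0}"
    by auto
  obtain z where z: "Tr z = 1"
    using ex_Tr_eq_1 by blast
  have "2 * card {u \<in> frob_fixed r. Tr u = 0} = card (frob_fixed r)"
  proof (rule card_additive_kernel(1))
    show "rel_trace m r z \<in> frob_fixed r"
      using r by (intro rel_trace_in_frob_fixed)
    show "Tr (rel_trace m r z) \<noteq> 0"
      using r z by (simp add: Tr_rel_trace)
  qed (auto simp: Tr_add frob_fixed_simps)
  also have "\<dots> = 2 * 2 ^ (r - 1)"
    using r by (simp add: card_frob_fixed flip: power_Suc)
  finally show ?thesis
    using U by simp
qed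

text \<open>Now \<open>m div (2 * k)\<close> is even, so the relative trace kills
  \<open>inverse \<beta>\<close> and the value 1 is attained, on a coset of the zeros. The condition
  \<open>Tr u = 0\<close> is automatic: zeros are relative traces of even degree, and
  \<open>Tr_polar_self\<close> covers the coset.\<close>

lemma polar_map_directions_even:
  assumes \<beta>: "\<beta> \<in> frob_fixed k" "\<beta> \<noteq> 0" and s: "4 dvd s"
  shows "card {u. Tr u = 0 \<and> polar_map \<beta> u \<in> {0, 1}} = 2 ^ (2 * k + 1)"
proof -
  let ?r = "2 * k" and ?F = "\<lambda>c. {u. polar_map \<beta> u = c}"
  obtain j where j: "s = 4 * j"
    using s by blast
  have r: "?r > 0" "?r dvd m" "even (m div ?r)"
    using k_pos m_eq j by auto
  have F0: "?F 0 = frob_fixed ?r"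
    using \<beta> frob_fixed_simps(1)[of k]
    by (simp add: polar_map_eq_iff add_eq_0_iff frob_fixed_def)
  have "inverse \<beta> \<in> frob_fixed ?r"
    using \<beta> frob_fixed_simps(4) frob_fixed_mono[of k ?r] by auto
  then have "rel_trace m ?r (inverse \<beta>) = 0"
    using r by (simp add: rel_trace_of_fixed)
  then obtain u0 where "inverse \<beta> = u0 ^ 2 ^ ?r + u0"
    using rel_trace_kernel[OF r(1,2)] by (auto simp: set_eq_iff)
  then have u0: "polar_map \<beta> u0 = 1"
    using \<beta> frob_fixed_simps(2) by (simp add: polar_map_eq_iff)
  have "?F 1 = (+) u0 ` ?F 0"
  proof (intro equalityI subsetI)
    fix u assume "u \<in> ?F 1"
    then have "polar_map \<beta> (u0 + u) = 0"
      by (simp add: polar_map_add u0)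
    then show "u \<in> (+) u0 ` ?F 0"
      by (intro image_eqI[where x = "u0 + u"]) (simp_all flip: add.assoc)
  qed (auto simp: polar_map_add u0)
  then have card1: "card (?F 1) = card (?F 0)"
    by (simp add: card_image)
  have "Tr u = 0" if "polar_map \<beta> u = 1" for u
    using Tr_polar_self[OF gold_polar[OF \<beta>(1), of _ _ 0], of u] that by simp
  moreover have "Tr u = 0" if "polar_map \<beta> u = 0" for u
  proof -
    have "u \<in> range (rel_trace m ?r)"
      using that F0 range_rel_trace[OF r(1,2)] by blast
    then show ?thesis
      using r by (auto simp: Tr_rel_trace)
  qed
  ultimately have "{u. Tr u = 0 \<and> polar_map \<beta> u \<in> {0, 1}} = ?F 0 \<union> ?F 1"
    by auto
  also have "card \<dots> = card (?F 0) + card (?F 1)"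
    by (intro card_Un_disjoint) auto
  also have "\<dots> = 2 ^ (?r + 1)"
    unfolding card1 unfolding F0 using r by (simp add: card_frob_fixed)
  finally show ?thesis .
qed

section \<open>The codewords and their parametrisation\<close>

definition gold_word :: "'a \<Rightarrow> 'a \<Rightarrow> 'a \<Rightarrow> bit" where
  "gold_word \<beta> b = (\<lambda>x. if Tr x = 1 then Tr (\<beta> * x ^ (2 ^ k + 1) + b * x) else 0)"

abbreviation gold_code :: "('a \<Rightarrow> bit) set" where
  "gold_code \<equiv> (\<lambda>(\<beta>, b). gold_word \<beta> b) ` (frob_fixed k \<times> UNIV)"

text \<open>By adjointness \<open>a\<close> enters only through its relative trace, which takes
  every value in \<open>frob_fixed k\<close>. The reduced parameters make an exact count of
  codewords possible.\<close>

lemma trace_code_eq_gold_code: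
  assumes f: "\<And>x. f x = rel_trace m k (x ^ (2 ^ k + 1))"
  shows "trace_code m f (trace_one_set m) = gold_code"
proof -
  have dvd: "k dvd m"
    using m_eq by simp
  have "Tr (a * f x + b * x) = Tr (rel_trace m k a * x ^ (2 ^ k + 1) + b * x)" for a b x
    by (simp only: f Tr_add Tr_rel_trace_adjoint[OF dvd])
  then have "(\<lambda>x. if x \<in> trace_one_set m then Tr (a * f x + b * x) else 0) =
      gold_word (rel_trace m k a) b" for a b
    unfolding gold_word_def trace_one_set_eq mem_Collect_eq by (simp only: cong: if_cong)
  then have "trace_code m f (trace_one_set m) = {gold_word (rel_trace m k a) b |a b. True}"
    by (simp add: trace_code_def)
  also have "\<dots> = (\<lambda>(\<beta>, b). gold_word \<beta> b) ` (range (rel_trace m k) \<times> UNIV)"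
    by auto
  finally show ?thesis
    using range_rel_trace[OF k_pos dvd] by simp
qed

lemma gold_word_add: "gold_word \<beta> b + gold_word \<beta>' b' = gold_word (\<beta> + \<beta>') (b + b')"
  by (auto simp: gold_word_def fun_eq_iff distrib_right Tr_add)

lemma gold_word_0: "gold_word 0 0 = 0"
  by (auto simp: gold_word_def)

lemma gold_code_F2: "gold_code \<subseteq> F2_space {x. Tr x = 1}" "F2_subspace gold_code"
proof -
  show "gold_code \<subseteq> F2_space {x. Tr x = 1}"
    by (auto simp: gold_word_def F2_space_def)
  show "F2_subspace gold_code"
    unfolding F2_subspace_iff
  proof (intro conjI ballI)
    show "0 \<in> gold_code"
      using gold_word_0 frob_fixed_simps(1)[of k] by (intro image_eqI[where x = "(0, 0)"]) auto
    show "u + v \<in> gold_code" if "u \<in> gold_code" "v \<in> gold_code" for u v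
      using that frob_fixed_simps(3)[of _ k] by (fastforce simp: gold_word_add)
  qed
qed

lemma F2_indicator_in_gold_code: "F2_indicator {x. Tr x = 1} \<in> gold_code"
  using frob_fixed_simps(1)[of k]
  by (intro image_eqI[where x = "(0, 1)"]) (auto simp: gold_word_def F2_indicator_def)

lemma gold_code_separates:
  assumes "Tr x = 1" "Tr y = 1" "x \<noteq> y"
  shows "\<exists>c\<in>gold_code. c x \<noteq> c y"
proof -
  have "x + y \<noteq> 0"
    using assms by (simp add: add_eq_0_iff)
  then obtain b where "Tr (b * (x + y)) = 1"
    using Tr_nondegenerate by (metis mult.commute)
  then have "gold_word 0 b x \<noteq> gold_word 0 b y"
    using assms by (auto simp: gold_word_def distrib_left Tr_add simp del: bit_not_zero_iff)
  then show ?thesis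
    using frob_fixed_simps(1)[of k] by (intro bexI[where x = "gold_word 0 b"]) auto
qed

lemma weight_gold_word:
  assumes "\<beta> \<in> frob_fixed k"
  shows "(2 ^ (m - 1) - 2 * int (weight (gold_word \<beta> b)))\<^sup>2 \<in>
    {0, 2 ^ (m - 1) * int (card {u. Tr u = 0 \<and> polar_map \<beta> u \<in> {0, 1}})}"
proof -
  let ?D = "{x. Tr x = 1}"
  have "gold_word \<beta> b \<in> F2_space ?D"
    using gold_code_F2(1) assms by auto
  then have "2 ^ (m - 1) - 2 * int (weight (gold_word \<beta> b)) =
      (\<Sum>x\<in>?D. bit_sign (gold_word \<beta> b x))"
    by (subst sum_bit_sign_eq_weight) (auto simp: card_Tr_fibre)
  also have "\<dots> = (\<Sum>x\<in>?D. bit_sign (Tr (\<beta> * x ^ (2 ^ k + 1) + b * x)))"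
    by (intro sum.cong) (auto simp: gold_word_def)
  finally have eq: "2 ^ (m - 1) - 2 * int (weight (gold_word \<beta> b)) =
      (\<Sum>x\<in>?D. bit_sign (Tr (\<beta> * x ^ (2 ^ k + 1) + b * x)))" .
  show ?thesis
    unfolding eq
    by (rule trace_one_quadratic_sum_square[where L = "polar_map \<beta>", OF _ polar_map_add])
      (rule gold_polar[OF assms])
qed

text \<open>A zero word would have character sum \<open>2 ^ (m - 1)\<close>, which occurs for
  \<open>b = 0\<close> only; for \<open>b = 1\<close> the sign is opposite.\<close>

lemma gold_word_nonzero:
  assumes "\<beta> = 0" "b \<noteq> 0"
  shows "gold_word \<beta> b \<noteq> 0"
proof
  assume 0: "gold_word \<beta> b = 0"
  have "Tr (b * y) = 0" if "Tr y = 1" for y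
    using that assms fun_cong[OF 0, of y] by (simp add: gold_word_def)
  then have "(\<Sum>y | Tr y = 1. bit_sign (Tr (b * y))) = 2 ^ (m - 1)"
    by (simp add: card_Tr_fibre)
  then show False
    using assms sum_trace_one_character[of b] by (auto split: if_splits)
qed

text \<open>Identifies the nonzero value of the squared character sum with
  \<open>4 * t\<^sup>2\<close>, by comparing exponents of 2 in the three cases for
  \<open>s\<close>.\<close>

lemma card_polar_map_directions:
  assumes \<beta>: "\<beta> \<in> frob_fixed k" "\<beta> \<noteq> 0" and m: "m \<ge> 4" and s: "s \<ge> 3"
    and t1: "multiplicity 2 m > multiplicity 2 k + 1 \<Longrightarrow> t = 2 ^ ((m + 2 * k - 2) div 2)"
    and t2: "multiplicity 2 m = multiplicity 2 k + 1 \<Longrightarrow> t = 2 ^ ((m + 2 * k - 4) div 2)"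
    and t3: "multiplicity 2 m = multiplicity 2 k \<Longrightarrow> t = 2 ^ ((m + k - 4) div 2)"
  shows "2 ^ (m - 1) * card {u. Tr u = 0 \<and> polar_map \<beta> u \<in> {0, 1}} = 4 * t\<^sup>2"
proof -
  have four: "4 * (2 ^ e)\<^sup>2 = (2 :: nat) ^ (2 * e + 2)" for e
    by (simp add: power_add mult.commute flip: power_mult)
  obtain e where e: "t = 2 ^ e"
    and "odd s \<and> m + k = 2 * e + 4 \<or> (\<exists>j. s = 2 * j \<and> odd j) \<and> m + 2 * k = 2 * e + 4 \<or>
      4 dvd s \<and> m + 2 * k = 2 * e + 2"
    using amplitude_exponent[OF m_eq m k_pos s t1 t2 t3] by blast
  then consider "odd s" "m + k = 2 * e + 4" | j where "s = 2 * j" "odd j" "m + 2 * k = 2 * e + 4"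
    | "4 dvd s" "m + 2 * k = 2 * e + 2"
    by blast
  then show ?thesis
  proof cases
    case 1
    have "card {u. Tr u = 0 \<and> polar_map \<beta> u \<in> {0, 1}} = 2 ^ (k - 1)"
      using 1 m_eq k_pos frob_fixed_double by (intro polar_map_directions_odd \<beta>) auto
    moreover have "(m - 1) + (k - 1) = 2 * e + 2"
      using 1 m k_pos by simp
    ultimately show ?thesis
      using 1 e four by (simp flip: power_add)
  next
    case (2 j)
    have "card {u. Tr u = 0 \<and> polar_map \<beta> u \<in> {0, 1}} = 2 ^ (2 * k - 1)"
      using 2 m_eq k_pos by (intro polar_map_directions_odd \<beta>) auto
    moreover have "(m - 1) + (2 * k - 1) = 2 * e + 2"
      using 2 m k_pos by simp
    ultimately show ?thesis
      using 2 e four by (simp flip: power_add)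
  next
    case 3
    have "(m - 1) + (2 * k + 1) = 2 * e + 2"
      using 3 m by simp
    then show ?thesis
      using polar_map_directions_even[OF \<beta> 3(1)] 3 e four by (simp flip: power_add)
  qed
qed

section \<open>Weights and number of the codewords\<close>

context
  fixes t :: nat
  assumes directions: "\<And>\<beta>. \<beta> \<in> frob_fixed k \<Longrightarrow> \<beta> \<noteq> 0 \<Longrightarrow>
      2 ^ (m - 1) * card {u. Tr u = 0 \<and> polar_map \<beta> u \<in> {0, 1}} = 4 * t\<^sup>2"
    and t_less: "t < 2 ^ (m - 2)" and m_ge_2: "m \<ge> 2"
begin

lemma weight_gold_word_cases:
  assumes \<beta>: "\<beta> \<in> frob_fixed k"
  shows "weight (gold_word \<beta> b) \<in>
    (if \<beta> = 0 then {0, 2 ^ (m - 2), 2 * 2 ^ (m - 2)}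
     else {2 ^ (m - 2) - t, 2 ^ (m - 2), 2 ^ (m - 2) + t})"
proof -
  let ?h = "2 ^ (m - 2) :: nat" and ?w = "weight (gold_word \<beta> b)"
  \<comment> \<open>For \<open>\<beta> = 0\<close> the polar map vanishes, so all
    \<open>2 ^ (m - 1)\<close> elements of trace 0 are directions and the deviation from
    \<open>?h\<close> is 0 or \<open>?h\<close> itself.\<close>
  define r where "r = (if \<beta> = 0 then ?h else t)"
  have "2 ^ (m - 1) * card {u. Tr u = 0 \<and> polar_map \<beta> u \<in> {0, 1}} = 4 * r\<^sup>2"
  proof (cases "\<beta> = 0")
    case True
    then show ?thesis
      by (simp add: r_def polar_map_def card_Tr_fibre two_power_pred[OF m_ge_2, simplified] power2_eq_square)
  qed (use directions \<beta> in \<open>simp add: r_def\<close>)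
  then have "int (2 ^ (m - 1) * card {u. Tr u = 0 \<and> polar_map \<beta> u \<in> {0, 1}}) = int (4 * r\<^sup>2)"
    by (rule arg_cong)
  then have U: "2 ^ (m - 1) * int (card {u. Tr u = 0 \<and> polar_map \<beta> u \<in> {0, 1}}) = int (4 * r\<^sup>2)"
    by (simp only: of_nat_mult of_nat_power of_nat_numeral)
  have h: "(2 :: int) ^ (m - 1) = 2 * int ?h"
    using arg_cong[OF two_power_pred[OF m_ge_2], of int] by simp
  have "(2 * int ?h - 2 * int ?w)\<^sup>2 \<in> {0, int (4 * r\<^sup>2)}"
    using weight_gold_word[OF \<beta>, of b] unfolding U unfolding h .
  moreover have "(2 * int ?h - 2 * int ?w)\<^sup>2 = 4 * (int ?h - int ?w)\<^sup>2"
    by (simp add: power2_eq_square algebra_simps)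
  ultimately have "(int ?h - int ?w)\<^sup>2 = 0 \<or> (int ?h - int ?w)\<^sup>2 = (int r)\<^sup>2"
    by auto
  then have "int ?w = int ?h \<or> int ?w = int ?h - int r \<or> int ?w = int ?h + int r"
    unfolding power2_eq_iff by auto
  moreover have "r \<le> ?h"
    using t_less by (simp add: r_def)
  ultimately have "?w = ?h \<or> ?w = ?h - r \<or> ?w = ?h + r"
    by linarith
  then show ?thesis
    by (auto simp: r_def)
qed

text \<open>The sum of two equal words has weight 0, whereas \<open>t_less\<close> makes every
  weight with nonzero \<open>\<beta>\<close> positive. So the \<open>\<beta>\<close> agree, and
  \<open>gold_word_nonzero\<close> settles \<open>b\<close>.\<close>

lemma card_gold_code: "card gold_code = 2 ^ (m + k)"
proof -
  have "inj_on (\<lambda>(\<beta>, b). gold_word \<beta> b) (frob_fixed k \<times> UNIV)"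
  proof (rule inj_onI, clarify)
    fix \<beta> b \<beta>' b' assume \<beta>: "\<beta> \<in> frob_fixed k" "\<beta>' \<in> frob_fixed k"
      and eq: "gold_word \<beta> b = gold_word \<beta>' b'"
    have 0: "gold_word (\<beta> + \<beta>') (b + b') = 0"
      by (simp add: eq flip: gold_word_add)
    have "weight (gold_word (\<beta> + \<beta>') (b + b')) = 0"
      unfolding 0 by (simp add: weight_def)
    then have "\<beta> + \<beta>' = 0"
      using weight_gold_word_cases[of "\<beta> + \<beta>'" "b + b'"] \<beta> t_less
      by (auto simp: frob_fixed_simps split: if_splits)
    moreover have "b + b' = 0"
      using gold_word_nonzero[OF calculation] 0 by blast
    ultimately show "\<beta> = \<beta>' \<and> b = b'"
      by (simp add: add_eq_0_iff)
  qed
  then show ?thesis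
    using card_frob_fixed[of k] k_pos m_eq
    by (simp add: card_image card_cartesian_product card_UNIV power_add)
qed

end

end

section \<open>Parameters and weights of the code, and optimality of its dual\<close>

theorem theorem4p8:
  fixes m k t :: nat
    and f :: "'a::finite_field \<Rightarrow> 'a"
    and D :: "'a set"
    and C :: "('a \<Rightarrow> bit) set"
  assumes card: "card (UNIV :: 'a set) = 2 ^ m"
    and m: "m \<ge> 4"
    and k: "k > 0" "k dvd m" "k \<noteq> m" "2 * k \<noteq> m"
    and not_degenerate: "(m, k) \<noteq> (4, 1)"
    and f: "\<And>x. f x = rel_trace m k (x ^ (2 ^ k + 1))"
    and D: "D = trace_one_set m"
    and C: "C = trace_code m f D"
    and t1: "multiplicity 2 m > multiplicity 2 k + 1 \<Longrightarrow> t = 2 ^ ((m + 2 * k - 2) div 2)"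
    and t2: "multiplicity 2 m = multiplicity 2 k + 1 \<Longrightarrow> t = 2 ^ ((m + 2 * k - 4) div 2)"
    and t3: "multiplicity 2 m = multiplicity 2 k \<Longrightarrow> t = 2 ^ ((m + k - 4) div 2)"
  shows "binary_code D C (2 ^ (m - 1)) (m + k) (2 ^ (m - 2) - t) \<and>
    weight_mult C 0 = 1 \<and>
    real (weight_mult C (2 ^ (m - 2))) =
      2 ^ (m + k) - 2 + 2 ^ (2 * m - 3) * (1 - 2 ^ k) / (real t)\<^sup>2 \<and>
    real (weight_mult C (2 ^ (m - 2) - t)) = 2 ^ (2 * m - 4) * (2 ^ k - 1) / (real t)\<^sup>2 \<and>
    real (weight_mult C (2 ^ (m - 2) + t)) = 2 ^ (2 * m - 4) * (2 ^ k - 1) / (real t)\<^sup>2 \<and>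
    weight_mult C (2 ^ (m - 1)) = 1 \<and>
    (\<forall>c\<in>C. weight c \<in> {0, 2 ^ (m - 2) - t, 2 ^ (m - 2), 2 ^ (m - 2) + t, 2 ^ (m - 1)}) \<and>
    binary_code D (dual_code D C) (2 ^ (m - 1)) (2 ^ (m - 1) - m - k) 4 \<and>
    distance_optimal D (dual_code D C) (2 ^ (m - 1)) (2 ^ (m - 1) - m - k) 4"
proof -
  define s where "s = m div k"
  have m_eq: "m = k * s"
    using k by (simp add: s_def)
  interpret binary_field_extension m "TYPE('a)" k s
    using card k m_eq by unfold_locales
  have "s \<noteq> 0"
    using m_eq m by (intro notI) simp
  moreover have "s \<noteq> 1" "s \<noteq> 2"
    using m_eq k by auto
  ultimately have s: "s \<ge> 3"
    by simp
  have mk: "k + 3 \<le> m" "2 * k < m"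
  proof -
    have "k * 3 \<le> m"
      unfolding m_eq using s by (intro mult_le_mono) auto
    then show "k + 3 \<le> m" "2 * k < m"
      using m k by auto
  qed
  let ?h = "2 ^ (m - 2) :: nat" and ?D = "{x :: 'a. Tr x = 1}"
  have t: "0 < t" "t < ?h"
  proof -
    obtain e where e: "t = 2 ^ e"
      and "odd s \<and> m + k = 2 * e + 4 \<or> (\<exists>j. s = 2 * j \<and> odd j) \<and> m + 2 * k = 2 * e + 4 \<or>
      4 dvd s \<and> m + 2 * k = 2 * e + 2"
      using amplitude_exponent[OF m_eq m k(1) s t1 t2 t3] by blast
    then consider "odd s" "m + k = 2 * e + 4" | j where "s = 2 * j" "odd j" "m + 2 * k = 2 * e + 4"
      | "4 dvd s" "m + 2 * k = 2 * e + 2"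
      by blast
    then have "e < m - 2"
    proof cases
      case 3
      \<comment> \<open>The pair \<open>(m, k) = (4, 1)\<close> would give \<open>t = ?h\<close> and
        is excluded; \<open>k = 1\<close> then forces \<open>m\<close> to be at least 8.\<close>
      have "2 * k + 2 < m"
      proof (cases "k = 1")
        case True
        then show ?thesis
          using m_eq not_degenerate 3 s by auto
      next
        case False
        have "k * 4 \<le> m"
          unfolding m_eq using 3 s by (intro mult_le_mono) (auto dest: dvd_imp_le)
        then show ?thesis
          using False k(1) by simp
      qed
      then show ?thesis
        using 3 by simp
    qed (use mk in auto)
    then show "0 < t" "t < ?h"
      by (simp_all add: e)
  qed
  have directions: "2 ^ (m - 1) * card {u. Tr u = 0 \<and> polar_map \<beta> u \<in> {0, 1}} = 4 * t\<^sup>2"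
    if "\<beta> \<in> frob_fixed k" "\<beta> \<noteq> 0" for \<beta> :: 'a
    by (rule card_polar_map_directions[OF that m s t1 t2 t3])
  have m2: "m \<ge> 2"
    using m by simp
  note ctx = directions t(2) m2
  have C_eq: "C = gold_code" and D_eq: "D = ?D"
    unfolding C D using trace_code_eq_gold_code[OF f] by (simp_all add: trace_one_set_eq)
  have finD: "finite D"
    by simp
  have h: "2 ^ (m - 1) = 2 * ?h"
    by (rule two_power_pred[OF m2])
  have cardD: "card D = 2 * ?h"
    unfolding D_eq card_Tr_fibre by (rule h)
  have C_F2: "C \<subseteq> F2_space D" "F2_subspace C" and ones: "F2_indicator D \<in> C"
    unfolding C_eq D_eq by (fact gold_code_F2 F2_indicator_in_gold_code)+
  have sep: "\<exists>c\<in>C. c i \<noteq> c j" if "i \<in> D" "j \<in> D" "i \<noteq> j" for i j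
    using gold_code_separates[of i j] that unfolding C_eq D_eq by simp
  have cardC: "card C = 2 ^ (m + k)"
    unfolding C_eq by (rule card_gold_code[OF ctx])
  have weights: "weight c \<in> {0, ?h - t, ?h, ?h + t, 2 * ?h}" if c: "c \<in> C" for c
  proof -
    obtain \<beta> b where "\<beta> \<in> frob_fixed k" "c = gold_word \<beta> b"
      using c unfolding C_eq by auto
    then show ?thesis
      using weight_gold_word_cases[OF ctx, of \<beta> b] by (auto split: if_splits)
  qed
  note dist = five_weight_distribution[OF finD C_F2 ones sep cardD t weights]
  let ?N = "weight_mult C (?h - t)"
  have pow: "(2 :: real) ^ m = 4 * real ?h" "(2 :: real) ^ (2 * m - 4) = (real ?h)\<^sup>2"
    "(2 :: real) ^ (2 * m - 3) = 2 * (real ?h)\<^sup>2"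
  proof -
    have e: "m = 2 + (m - 2)" "2 * m - 4 = (m - 2) * 2" "2 * m - 3 = Suc ((m - 2) * 2)"
      using m by auto
    show "(2 :: real) ^ m = 4 * real ?h"
      by (subst e(1)) (simp add: power_add)
    show "(2 :: real) ^ (2 * m - 4) = (real ?h)\<^sup>2" "(2 :: real) ^ (2 * m - 3) = 2 * (real ?h)\<^sup>2"
      unfolding e(2,3) by (simp_all add: power_mult)
  qed
  \<comment> \<open>The second moment equation; inserting \<open>2 ^ m = 4 * ?h\<close> isolates the
    multiplicity of the weights \<open>?h - t\<close> and \<open>?h + t\<close>.\<close>
  have "real (4 * t\<^sup>2 * ?N + 4 * ?h\<^sup>2) = real (?h * 2 ^ (m + k))"
    using dist(4) cardC by simp
  then have "(real t)\<^sup>2 * real ?N = (real ?h)\<^sup>2 * (2 ^ k - 1)"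
    by (simp add: power_add pow(1) algebra_simps power2_eq_square)
  then have N: "real ?N = (real ?h)\<^sup>2 * (2 ^ k - 1) / (real t)\<^sup>2"
    using t by (simp add: field_simps)
  have "real (weight_mult C ?h + 2 * ?N + 2) = real (2 ^ (m + k))"
    using dist(5) cardC by simp
  then have N0: "real (weight_mult C ?h) = 2 ^ (m + k) - 2 - 2 * real ?N"
    by simp
  have "(2 :: real) ^ k > 1"
    using k by simp
  then have "real ?N > 0"
    unfolding N using t by simp
  then have "{c \<in> C. weight c = ?h - t} \<noteq> {}"
    unfolding weight_mult_def by (metis card.empty of_nat_0 less_irrefl)
  then obtain c where "c \<in> C" "weight c = ?h - t"
    by auto
  moreover have "c \<noteq> 0"
    using calculation t weight_eq_0_iff[OF finD, of c] C_F2 by auto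
  moreover have "?h - t \<le> weight c" if "c \<in> C" "c \<noteq> 0" for c
    using weights[OF that(1)] that weight_eq_0_iff[OF finD, of c] C_F2 by auto
  ultimately have "has_min_dist C (?h - t)"
    unfolding has_min_dist_F2_subspace[OF C_F2(2)] by blast
  moreover have "finite C"
    using C_F2 finite_F2_space[OF finD] finite_subset by blast
  ultimately have code: "binary_code D C (2 ^ (m - 1)) (m + k) (?h - t)"
    unfolding binary_code_def using finD cardD C_F2 F2_dim_eqI cardC h by simp
  have dual: "distance_optimal D (dual_code D C) (2 ^ (m - 1)) (2 ^ (m - 1) - (m + k)) 4"
  proof (rule dual_code_distance_optimal[OF finD _ C_F2 ones sep cardC])
    show "card D = 2 ^ (m - 1)"
      using cardD h by simp
    \<comment> \<open>With \<open>k + 3 \<le> m\<close> this gives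
      \<open>m + k \<le> 2 * m - 3 < 2 * ?h\<close>.\<close>
    have "m - 2 < ?h"
      by (rule less_exp)
    then show "m + k < 2 ^ (m - 1)"
      unfolding h using mk by linarith
    \<comment> \<open>For length \<open>2 * ?h\<close> the ball of radius 2 has
      \<open>2 * ?h\<^sup>2 + ?h + 1\<close> points, just above the bound
      \<open>2 * ?h\<^sup>2\<close> for \<open>2 ^ (m + k)\<close>.\<close>
    have "2 ^ (m + k) \<le> (2 :: nat) ^ (2 * m - 3)"
      using mk by (intro power_increasing) auto
    also have "2 * m - 3 = Suc ((m - 2) + (m - 2))"
      using m by simp
    also have "2 ^ \<dots> = 2 * (?h * ?h)"
      by (simp add: power_add)
    also have "\<dots> < 1 + 2 * ?h + ?h * (2 * ?h - 1)"
      by (simp add: diff_mult_distrib2)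
    also have "?h * (2 * ?h - 1) = (2 * ?h choose 2)"
      by (simp add: choose_two)
    finally show "2 ^ (m + k) < 1 + 2 ^ (m - 1) + (2 ^ (m - 1) choose 2)"
      unfolding h .
  qed
  have "real (weight_mult C ?h) = 2 ^ (m + k) - 2 + 2 ^ (2 * m - 3) * (1 - 2 ^ k) / (real t)\<^sup>2"
    unfolding N0 N pow(3) using t by (simp add: field_simps)
  moreover have "real ?N = 2 ^ (2 * m - 4) * (2 ^ k - 1) / (real t)\<^sup>2"
    unfolding pow(2) by (rule N)
  moreover have "weight_mult C (2 ^ (m - 1)) = 1"
    unfolding h by (rule dist(2))
  moreover have "\<forall>c\<in>C. weight c \<in> {0, ?h - t, ?h, ?h + t, 2 ^ (m - 1)}"
    unfolding h using weights by blast
  ultimately show ?thesis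
    using code dual dist(1,3) by (simp only: distance_optimal_def diff_diff_left simp_thms)
qed

end
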